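(* Let $S$ be a subordinator with $\mathbb{E}(S_1^2)<\infty$, $d\in(-0.5,0)$ and $a>0$. Then the process $(S^{a,d}_t)_{t\in\mathbb{R}}$ defined by $S^{a,d}_t=\int_{\mathbb{R}}f_{a,d}(t,u)\,\mathrm{d}S_u$ has a modification that equals the improper Riemann integral $$S_t^{a,d}=d\int_{\mathbb{R}}\Big((a+(-s)_+)^{d-1}-(a+(t-s)_+)^{d-1}\Big)S_s\,\mathrm{d}s-d\,a^{d-1}\int_0^tS_s\,\mathrm{d}s,\qquad t\in\mathbb{R}.$$ Moreover, the right-hand side is continuous in $t$ and has sample paths of finite variation.
   Context: For $d\in(-0.5,0)$, $a>0$ the modified Mandelbrot-van-Ness kernel is $f_{a,d}(t,s)=(a+(-s)_+)^d-(a+(t-s)_+)^d$ for $t,s\in\mathbb{R}$, where $x_+=\max\{x,0\}$. A subordinator is a L\'evy process with almost surely increasing sample paths. It is extended to a two-sided process $(S_t)_{t\in\mathbb{R}}$ by $S_t=-S^{(1)}_{(-t)-}\mathbf{1}_{\{t<0\}}+S^{(2)}_t\mathbf{1}_{\{t\ge0\}}$, with $S^{(1)},S^{(2)}$ independent identically distributed copies of $S$. The integral defining $S^{a,d}_t$ is the limit in $L^2(\Omega)$ (hence in probability) of integrals of approximating step functions. For $t<0$, $\int_0^t=-\int_t^0$. *)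

theory Defs
  imports "HOL-Probability.Probability"
begin

section \<open>Levy processes and subordinators\<close>

text \<open>
  Processes on the half line are functions on the reals of which only the values at times
  \<open>t \<ge> 0\<close> are ever used.
\<close>

definition cadlag_path :: "(real \<Rightarrow> real) \<Rightarrow> bool" where
  "cadlag_path x \<longleftrightarrow>
     (\<forall>t\<ge>0. (x \<longlongrightarrow> x t) (at_right t)) \<and> (\<forall>t>0. \<exists>l. (x \<longlongrightarrow> l) (at_left t))"

locale levy_process = prob_space M for M :: "'a measure" +
  fixes X :: "real \<Rightarrow> 'a \<Rightarrow> real"
  assumes random_variable: "\<And>t. t \<ge> 0 \<Longrightarrow> X t \<in> borel_measurable M"
    and starts_at_zero: "AE \<omega> in M. X 0 \<omega> = 0"
    and independent_increments:
      "\<And>(t :: nat \<Rightarrow> real) n. \<lbrakk>0 \<le> t 0; \<And>i. i < n \<Longrightarrow> t i \<le> t (Suc i)\<rbrakk> \<Longrightarrow>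
         indep_vars (\<lambda>_. borel) (\<lambda>i \<omega>. X (t (Suc i)) \<omega> - X (t i) \<omega>) {..<n}"
    and stationary_increments:
      "\<And>s h. \<lbrakk>s \<ge> 0; h \<ge> 0\<rbrakk> \<Longrightarrow>
         distr M borel (\<lambda>\<omega>. X (s + h) \<omega> - X s \<omega>) = distr M borel (\<lambda>\<omega>. X h \<omega> - X 0 \<omega>)"
    and stochastically_continuous:
      "\<And>t \<epsilon>. \<lbrakk>t \<ge> 0; \<epsilon> > 0\<rbrakk> \<Longrightarrow>
         ((\<lambda>s. prob {\<omega> \<in> space M. \<bar>X s \<omega> - X t \<omega>\<bar> > \<epsilon>}) \<longlongrightarrow> 0) (at t within {0..})"
    and AE_cadlag: "AE \<omega> in M. cadlag_path (\<lambda>t. X t \<omega>)"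

locale subordinator = levy_process +
  assumes AE_increasing: "AE \<omega> in M. mono_on {0..} (\<lambda>t. X t \<omega>)"

definition sample_path :: "(real \<Rightarrow> 'a \<Rightarrow> real) \<Rightarrow> 'a \<Rightarrow> real \<Rightarrow> real" where
  "sample_path X \<omega> = (\<lambda>t\<in>{0..}. X t \<omega>)"

definition path_space :: "(real \<Rightarrow> real) measure" where
  "path_space = PiM {0..} (\<lambda>_. borel)"

definition same_law ::
  "'a measure \<Rightarrow> (real \<Rightarrow> 'a \<Rightarrow> real) \<Rightarrow> 'b measure \<Rightarrow> (real \<Rightarrow> 'b \<Rightarrow> real) \<Rightarrow> bool" where
  "same_law M X N Y \<longleftrightarrow>
     distr M path_space (sample_path X) = distr N path_space (sample_path Y)"

definition two_sided ::
  "(real \<Rightarrow> 'a \<Rightarrow> real) \<Rightarrow> (real \<Rightarrow> 'a \<Rightarrow> real) \<Rightarrow> real \<Rightarrow> 'a \<Rightarrow> real" where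
  "two_sided X1 X2 t \<omega> = (if t < 0 then - Lim (at_left (- t)) (\<lambda>s. X1 s \<omega>) else X2 t \<omega>)"

definition modification ::
  "'a measure \<Rightarrow> (real \<Rightarrow> 'a \<Rightarrow> real) \<Rightarrow> (real \<Rightarrow> 'a \<Rightarrow> real) \<Rightarrow> bool" where
  "modification M Y X \<longleftrightarrow>
     (\<forall>t. Y t \<in> borel_measurable M \<and> (AE \<omega> in M. Y t \<omega> = X t \<omega>))"


section \<open>Integrals of deterministic functions with respect to a process\<close>

text \<open>A triple \<open>(c, u, v)\<close> with \<open>u \<le> v\<close> stands for the summand \<open>c\<close> times the indicator of \<open>(u, v]\<close>.\<close>

type_synonym step = "(real \<times> real \<times> real) list"

definition is_step :: "step \<Rightarrow> bool" where
  "is_step \<phi> \<longleftrightarrow> (\<forall>(c, u, v) \<in> set \<phi>. u \<le> v)"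

definition step_fun :: "step \<Rightarrow> real \<Rightarrow> real" where
  "step_fun \<phi> x = (\<Sum>(c, u, v)\<leftarrow>\<phi>. c * indicator {u<..v} x)"

definition step_integral :: "(real \<Rightarrow> 'a \<Rightarrow> real) \<Rightarrow> step \<Rightarrow> 'a \<Rightarrow> real" where
  "step_integral X \<phi> \<omega> = (\<Sum>(c, u, v)\<leftarrow>\<phi>. c * (X v \<omega> - X u \<omega>))"

text \<open>
  For a square integrable Levy process with mean \<open>\<mu>\<close> and variance \<open>\<sigma>\<^sup>2\<close> at time one, the second
  moment of the integral of a step function \<open>\<phi>\<close> is \<open>\<sigma>\<^sup>2 \<integral>\<phi>\<^sup>2 + \<mu>\<^sup>2 (\<integral>\<phi>)\<^sup>2\<close>.  As the mean of a
  subordinator need not vanish, approximation is required in both L1 and L2 of the real line.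
\<close>

definition approximating_steps :: "(nat \<Rightarrow> step) \<Rightarrow> (real \<Rightarrow> real) \<Rightarrow> bool" where
  "approximating_steps \<phi> f \<longleftrightarrow>
     (\<forall>n. is_step (\<phi> n)) \<and>
     (\<lambda>n. \<integral>\<^sup>+ x. ennreal \<bar>step_fun (\<phi> n) x - f x\<bar> \<partial>lborel) \<longlonglongrightarrow> 0 \<and>
     (\<lambda>n. \<integral>\<^sup>+ x. ennreal ((step_fun (\<phi> n) x - f x)\<^sup>2) \<partial>lborel) \<longlonglongrightarrow> 0"

text \<open>The integral is determined only up to null sets, hence a relation rather than a function.\<close>

definition has_L2_integral ::
  "'a measure \<Rightarrow> (real \<Rightarrow> 'a \<Rightarrow> real) \<Rightarrow> (real \<Rightarrow> real) \<Rightarrow> ('a \<Rightarrow> real) \<Rightarrow> bool" where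
  "has_L2_integral M X f Z \<longleftrightarrow>
     f \<in> borel_measurable borel \<and> Z \<in> borel_measurable M \<and> integrable M (\<lambda>\<omega>. (Z \<omega>)\<^sup>2) \<and>
     (\<exists>\<phi>. approximating_steps \<phi> f) \<and>
     (\<forall>\<phi>. approximating_steps \<phi> f \<longrightarrow>
        (\<lambda>n. \<integral>\<^sup>+ \<omega>. ennreal ((step_integral X (\<phi> n) \<omega> - Z \<omega>)\<^sup>2) \<partial>M) \<longlonglongrightarrow> 0)"

definition mvn_kernel :: "real \<Rightarrow> real \<Rightarrow> real \<Rightarrow> real \<Rightarrow> real" where
  "mvn_kernel a d t s = (a + max (- s) 0) powr d - (a + max (t - s) 0) powr d"


section \<open>Riemann integrals and finite variation\<close>

text \<open>
  The library's gauge integral with the gauge restricted to balls of constant radius, that is,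
  the limit of Riemann sums as the mesh tends to zero.
\<close>

definition has_riemann_integral :: "(real \<Rightarrow> real) \<Rightarrow> real \<Rightarrow> real \<Rightarrow> real \<Rightarrow> bool" where
  "has_riemann_integral g u v I \<longleftrightarrow>
     (\<forall>e>0. \<exists>\<delta>>0. \<forall>p. p tagged_division_of {u..v} \<and> (\<lambda>x. ball x \<delta>) fine p \<longrightarrow>
        \<bar>(\<Sum>(x, K)\<in>p. measure lborel K * g x) - I\<bar> < e)"

definition riemann_integrable :: "(real \<Rightarrow> real) \<Rightarrow> real \<Rightarrow> real \<Rightarrow> bool" where
  "riemann_integrable g u v \<longleftrightarrow> (\<exists>I. has_riemann_integral g u v I)"

text \<open>The integral from \<open>u\<close> to \<open>v\<close>, with the usual sign convention if \<open>v < u\<close>.\<close>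

definition riemann_integral :: "(real \<Rightarrow> real) \<Rightarrow> real \<Rightarrow> real \<Rightarrow> real" where
  "riemann_integral g u v =
     (if u \<le> v then THE I. has_riemann_integral g u v I
      else - (THE I. has_riemann_integral g v u I))"

definition has_improper_riemann_integral :: "(real \<Rightarrow> real) \<Rightarrow> real \<Rightarrow> bool" where
  "has_improper_riemann_integral g I \<longleftrightarrow>
     (\<forall>u v. u \<le> v \<longrightarrow> riemann_integrable g u v) \<and>
     ((\<lambda>(u, v). riemann_integral g u v) \<longlongrightarrow> I) (at_bot \<times>\<^sub>F at_top)"

definition improper_riemann_integral :: "(real \<Rightarrow> real) \<Rightarrow> real" where
  "improper_riemann_integral g = (THE I. has_improper_riemann_integral g I)"

definition finite_variation_on :: "(real \<Rightarrow> real) \<Rightarrow> real \<Rightarrow> real \<Rightarrow> bool" where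
  "finite_variation_on g u v \<longleftrightarrow>
     (\<exists>B. \<forall>(n :: nat) (t :: nat \<Rightarrow> real).
        u \<le> t 0 \<and> (\<forall>i<n. t i \<le> t (Suc i)) \<and> t n \<le> v \<longrightarrow>
        (\<Sum>i<n. \<bar>g (t (Suc i)) - g (t i)\<bar>) \<le> B)"

definition riemann_integrand ::
  "real \<Rightarrow> real \<Rightarrow> (real \<Rightarrow> 'a \<Rightarrow> real) \<Rightarrow> real \<Rightarrow> 'a \<Rightarrow> real \<Rightarrow> real" where
  "riemann_integrand a d X t \<omega> s =
     ((a + max (- s) 0) powr (d - 1) - (a + max (t - s) 0) powr (d - 1)) * X s \<omega>"

definition riemann_representation ::
  "real \<Rightarrow> real \<Rightarrow> (real \<Rightarrow> 'a \<Rightarrow> real) \<Rightarrow> real \<Rightarrow> 'a \<Rightarrow> real" where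
  "riemann_representation a d X t \<omega> =
     d * improper_riemann_integral (riemann_integrand a d X t \<omega>)
       - d * a powr (d - 1) * riemann_integral (\<lambda>s. X s \<omega>) 0 t"

end

theory Submission
  imports Defs
begin

text \<open>
  Write \<open>X\<close> for the two-sided process and \<open>f = mvn_kernel a d t\<close>.  The representation is integration by
  parts: \<open>f\<close> vanishes to the right of \<open>max 0 t\<close>, it tends to zero at minus infinity, and it is absolutely
  continuous with derivative \<open>h = kernel_slope a d t\<close>, so that formally
  \<open>\<integral> f dX = - \<integral> h(s) X\<^sub>s ds\<close>.  Rearranging the indicator functions in \<open>h\<close> turns the right-hand side into the
  improper Riemann integral of the statement (\<open>riemann_representation_eq_path_integral\<close>).

  The argument separates paths from moments.  For a single path \<open>x\<close> it suffices that \<open>x\<close> is increasing,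
  vanishes at zero and grows so slowly at minus infinity that \<open>\<bar>s\<bar> powr (d - 2) * x s\<close> is integrable there;
  the locale \<open>tempered_path\<close> collects these properties.  Since the difference of two kernel slopes at \<open>t\<close> and
  \<open>t'\<close> is bounded by \<open>\<bar>t - t'\<bar>\<close> times such a weight, up to a bounded term on \<open>{t..<t'}\<close>, the function
  \<open>t \<mapsto> - \<integral> h x\<close> is locally Lipschitz, hence continuous and of finite variation.  Moreover, the
  step functions that take the value of \<open>f\<close> at the left end of each cell of a uniform grid have integrals against
  \<open>x\<close> that converge to \<open>- \<integral> h x\<close> (\<open>step_integral_grid_tendsto\<close>).

  The second moments \<open>E (X\<^sub>s X\<^sub>t)\<close> of the two-sided process make the integral of step functions satisfy
  \<open>E (\<integral> \<phi> dX)\<^sup>2 = \<sigma>\<^sup>2 \<integral> \<phi>\<^sup>2 + \<mu>\<^sup>2 (\<integral> \<phi>)\<^sup>2\<close>.  Fatou's lemma, applied along the grid approximations, carries this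
  bound over to the pathwise limit: the distance in L2 between \<open>\<integral> \<phi> dX\<close> and \<open>- \<integral> h X\<close> is
  controlled by the distances of \<open>\<phi>\<close> from \<open>f\<close> in L1 and L2 (\<open>step_integral_limit_le\<close>).  Hence every
  approximating sequence of step functions leads to the same limit, which is the representation; this proves both
  that the stochastic integral exists and that it has the asserted form.

  It remains to see that almost all paths are tempered.  Moments of a subordinator grow linearly, so
  \<open>\<Sum>n. (a + n) powr (d - 2) * E S\<^sub>n\<^sub>+\<^sub>1\<close> is, up to a constant factor,
  dominated by \<open>\<Sum>n. n powr (d - 1)\<close>, which is finite because \<open>d < 0\<close>.
\<close>

section \<open>Riemann integrals of functions of bounded variation\<close>

lemma has_riemann_integral_imp_has_integral:
  assumes "has_riemann_integral g u v I"
  shows "(g has_integral I) {u..v}"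
  unfolding has_integral_real
proof (intro allI impI)
  fix e :: real assume "e > 0"
  with assms obtain r where r: "r > 0" and *: "\<And>p. p tagged_division_of {u..v} \<Longrightarrow> (\<lambda>x. ball x r) fine p \<Longrightarrow>
      \<bar>(\<Sum>(x, K)\<in>p. measure lborel K * g x) - I\<bar> < e"
    unfolding has_riemann_integral_def by meson
  show "\<exists>\<gamma>. gauge \<gamma> \<and> (\<forall>\<D>. \<D> tagged_division_of {u..v} \<and> \<gamma> fine \<D> \<longrightarrow>
          norm ((\<Sum>(x, k)\<in>\<D>. measure lborel k *\<^sub>R g x) - I) < e)"
    using r * by (intro exI[of _ "\<lambda>x. ball x r"]) (auto simp: gauge_ball)
qed

lemma riemann_integral_eqI:
  assumes "has_riemann_integral g u v I"
  shows "(THE I. has_riemann_integral g u v I) = I"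
  using assms has_integral_unique has_riemann_integral_imp_has_integral by blast

text \<open>
  On a cell of a partition the integrand oscillates by at most the increment of \<open>V\<close>, and these increments telescope
  to \<open>V v - V u\<close>.  The error of a Riemann sum of mesh \<open>r\<close> is thus at most \<open>2 * r * (V v - V u)\<close>, for any
  choice of tags.
\<close>

lemma has_riemann_integral_bounded_variation:
  fixes F V :: "real \<Rightarrow> real"
  assumes osc: "\<And>x y. \<lbrakk>u \<le> x; x \<le> y; y \<le> v\<rbrakk> \<Longrightarrow> \<bar>F y - F x\<bar> \<le> V y - V x"
    and F: "F integrable_on {u..v}" and uv: "u \<le> v"
  shows "has_riemann_integral F u v (integral {u..v} F)"
  unfolding has_riemann_integral_def
proof (intro allI impI)
  fix e :: real assume e: "e > 0"
  have V: "V x \<le> V y" if "u \<le> x" "x \<le> y" "y \<le> v" for x y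
    using osc[OF that] by linarith
  define T where "T = V v - V u"
  have T: "T \<ge> 0" using V[of u v] uv by (simp add: T_def)
  \<comment> \<open>The summand \<open>1\<close> keeps the quotient defined for constant \<open>V\<close>.\<close>
  define r where "r = e / (2 * T + 1) / 2"
  have r: "r > 0" using e T by (simp add: r_def)
  have rT: "2 * r * T < e"
  proof -
    have "2 * r * T = e * (T / (2 * T + 1))" using T by (simp add: r_def field_simps)
    also have "\<dots> < e * 1" using e T by (intro mult_strict_left_mono) (auto simp: divide_simps)
    finally show ?thesis by simp
  qed
  show "\<exists>\<delta>>0. \<forall>p. p tagged_division_of {u..v} \<and> (\<lambda>x. ball x \<delta>) fine p \<longrightarrow>
      \<bar>(\<Sum>(x, K)\<in>p. measure lborel K * F x) - integral {u..v} F\<bar> < e"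
  proof (intro exI[of _ r] conjI allI impI r, elim conjE)
    fix p assume p: "p tagged_division_of {u..v}" and fine: "(\<lambda>x. ball x r) fine p"
    have I: "integral {u..v} F = (\<Sum>(x, K)\<in>p. integral K F)"
      using integral_combine_tagged_division_topdown[of F u v p] F p by simp
    have bound: "\<bar>measure lborel K * F x - integral K F\<bar> \<le> 2 * r * (V (Sup K) - V (Inf K))"
      if xK: "(x, K) \<in> p" for x K
    proof -
      obtain b c where K: "K = {b..c}" using tagged_division_ofD(4)[OF p xK] by auto
      have x: "x \<in> K" and sub: "K \<subseteq> {u..v}" using tagged_division_ofD(2,3)[OF p xK] by auto
      then have bc: "b \<le> c" "u \<le> b" "c \<le> v" by (auto simp: K)
      have "K \<subseteq> ball x r" using fine xK by (auto simp: fine_def)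
      then have "b \<in> ball x r" "c \<in> ball x r" using bc by (auto simp: K)
      then have len: "c - b \<le> 2 * r" by (auto simp: dist_real_def)
      have FK: "F integrable_on {b..c}" using F sub K integrable_on_subinterval by metis
      have "\<bar>F y - F x\<bar> \<le> V c - V b" if "y \<in> {b..c}" for y
      proof (cases "x \<le> y")
        case True
        then show ?thesis using osc[of x y] V[of b x] V[of y c] that x bc K by auto
      next
        case False
        then show ?thesis using osc[of y x] V[of b y] V[of x c] that x bc K by auto
      qed
      then have *: "norm (F x - F y) \<le> V c - V b" if "y \<in> {b..c}" for y
        using that by (subst norm_minus_commute) simp
      have "(\<lambda>y. F x - F y) integrable_on cbox b c"
        using FK by (intro integrable_diff) auto
      then have "norm (integral {b..c} (\<lambda>y. F x - F y)) \<le> (V c - V b) * measure lborel {b..c}"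
        using integrable_bound[of "V c - V b" "\<lambda>y. F x - F y" b c] * V[of b c] bc by simp
      also have "integral {b..c} (\<lambda>y. F x - F y) = measure lborel K * F x - integral K F"
        using FK bc by (subst integral_diff) (auto simp: K)
      also have "(V c - V b) * measure lborel {b..c} \<le> (V c - V b) * (2 * r)"
        using len bc V[of b c] by (intro mult_left_mono) auto
      finally show ?thesis using bc by (simp add: K mult.commute)
    qed
    have "\<bar>(\<Sum>(x, K)\<in>p. measure lborel K * F x) - integral {u..v} F\<bar>
        = \<bar>\<Sum>(x, K)\<in>p. measure lborel K * F x - integral K F\<bar>"
      unfolding I by (simp add: sum_subtractf[symmetric] case_prod_unfold)
    also have "\<dots> \<le> (\<Sum>(x, K)\<in>p. \<bar>measure lborel K * F x - integral K F\<bar>)"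
      unfolding case_prod_unfold by (rule sum_abs)
    also have "\<dots> \<le> (\<Sum>(x, K)\<in>p. 2 * r * (V (Sup K) - V (Inf K)))"
      using bound by (intro sum_mono) auto
    also have "\<dots> = 2 * r * (\<Sum>(x, K)\<in>p. V (Sup K) - V (Inf K))"
      by (simp add: sum_distrib_left case_prod_unfold)
    also have "(\<Sum>(x, K)\<in>p. V (Sup K) - V (Inf K)) = T"
      using additive_tagged_division_1[OF uv p, of V] by (simp add: T_def)
    finally show "\<bar>(\<Sum>(x, K)\<in>p. measure lborel K * F x) - integral {u..v} F\<bar> < e"
      using rT by linarith
  qed
qed

lemma has_improper_riemann_integral_unique:
  assumes "has_improper_riemann_integral g I"
  shows "improper_riemann_integral g = I"
  unfolding improper_riemann_integral_def
proof (rule the_equality[where P = "has_improper_riemann_integral g"])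
  show "has_improper_riemann_integral g I" by fact
  show "J = I" if "has_improper_riemann_integral g J" for J
    using that assms tendsto_unique[of "at_bot \<times>\<^sub>F at_top :: (real \<times> real) filter"]
    by (auto simp: has_improper_riemann_integral_def prod_filter_eq_bot)
qed

section \<open>The kernel and its slope\<close>

text \<open>
  The kernel is a difference of two such powers, and its derivative is a combination of two of the truncated powers
  defined next.
\<close>

definition shifted_power :: "real \<Rightarrow> real \<Rightarrow> real \<Rightarrow> real \<Rightarrow> real" where
  "shifted_power a p t s = (a + max (t - s) 0) powr p"

definition past_power :: "real \<Rightarrow> real \<Rightarrow> real \<Rightarrow> real \<Rightarrow> real" where
  "past_power a p t s = indicator {..<t} s * shifted_power a p t s"

lemma shifted_power_nonneg [simp]: "0 \<le> shifted_power a p t s"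
  by (simp add: shifted_power_def)

lemma shifted_power_le:
  assumes "a > 0" "p \<le> 0"
  shows "shifted_power a p t s \<le> a powr p"
  unfolding shifted_power_def using assms by (intro powr_mono2') auto

lemma shifted_power_future: "t \<le> s \<Longrightarrow> shifted_power a p t s = a powr p"
  by (simp add: shifted_power_def max_def)

lemma mono_shifted_power:
  assumes "a > 0" "p \<le> 0"
  shows "mono (shifted_power a p t)"
  unfolding shifted_power_def using assms by (intro monoI powr_mono2') auto

lemma measurable_shifted_power [measurable]: "shifted_power a p t \<in> borel_measurable borel"
  unfolding shifted_power_def by measurable

lemma measurable_past_power [measurable]: "past_power a p t \<in> borel_measurable borel"
  unfolding past_power_def by measurable

lemma continuous_on_shifted_power: "a > 0 \<Longrightarrow> continuous_on A (shifted_power a p t)"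
  unfolding shifted_power_def by (intro continuous_intros) (auto simp: max_def)

lemma powr_diff_le:
  fixes p m y z :: real
  assumes "p \<le> 0" "0 < m" "m \<le> y" "m \<le> z"
  shows "\<bar>y powr p - z powr p\<bar> \<le> - p * m powr (p - 1) * \<bar>y - z\<bar>"
proof -
  have *: "\<bar>y powr p - z powr p\<bar> \<le> - p * m powr (p - 1) * \<bar>y - z\<bar>"
    if "m \<le> y" "y < z" for y z
  proof -
    have "\<And>x. \<lbrakk>y \<le> x; x \<le> z\<rbrakk> \<Longrightarrow> ((\<lambda>x. x powr p) has_real_derivative p * x powr (p - 1)) (at x)"
      using that assms(2) by (intro has_real_derivative_powr) auto
    from MVT2[OF \<open>y < z\<close> this] obtain x where x: "y < x" "x < z"
        "z powr p - y powr p = (z - y) * (p * x powr (p - 1))" by auto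
    have "\<bar>y powr p - z powr p\<bar> = - p * x powr (p - 1) * \<bar>y - z\<bar>"
      using x assms(1) by (auto simp: abs_minus_commute[of "y powr p"] abs_mult)
    also have "\<dots> \<le> - p * m powr (p - 1) * \<bar>y - z\<bar>"
      using x that assms by (intro mult_right_mono mult_left_mono powr_mono2') auto
    finally show ?thesis .
  qed
  show ?thesis
    using *[of y z] *[of z y] assms by (cases y z rule: linorder_cases) (auto simp: abs_minus_commute)
qed

text \<open>
  The source of local Lipschitz continuity in \<open>t\<close>.  The mean value theorem gains one power of decay where both
  functions are positive; on \<open>{t..<t'}\<close>, where only one of them is, boundedness suffices.
\<close>

lemma past_power_diff_le:
  assumes "a > 0" "p \<le> 0" "u \<le> t" "t \<le> t'"
  shows "\<bar>past_power a p t' s - past_power a p t s\<bar> \<le>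
    - p * (t' - t) * (indicator {..<t'} s * shifted_power a (p - 1) u s) + a powr p * indicator {t..<t'} s"
proof (cases "s < t")
  case True
  have "\<bar>past_power a p t' s - past_power a p t s\<bar> = \<bar>(a + (t' - s)) powr p - (a + (t - s)) powr p\<bar>"
    using True assms by (simp add: past_power_def shifted_power_def)
  also have "\<dots> \<le> - p * (a + max (u - s) 0) powr (p - 1) * \<bar>(a + (t' - s)) - (a + (t - s))\<bar>"
    using True assms by (intro powr_diff_le) auto
  finally show ?thesis using True assms by (simp add: shifted_power_def mult_ac)
next
  case False
  have "0 \<le> - p * (t' - t) * (indicator {..<t'} s * shifted_power a (p - 1) u s)"
    using assms by (intro mult_nonneg_nonneg) auto
  moreover have "\<bar>past_power a p t' s - past_power a p t s\<bar> \<le> a powr p * indicator {t..<t'} s"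
    using False shifted_power_le[OF assms(1,2), of t' s]
    by (auto simp: past_power_def split: split_indicator)
  ultimately show ?thesis by linarith
qed

lemma shifted_power_diff_le:
  assumes "a > 0" "p \<le> 0" "u \<le> t" "t \<le> t'"
  shows "\<bar>shifted_power a p t' s - shifted_power a p t s\<bar> \<le>
    - p * (t' - t) * (indicator {..<t'} s * shifted_power a (p - 1) u s)"
proof (cases "s < t'")
  case True
  have "\<bar>shifted_power a p t' s - shifted_power a p t s\<bar>
      \<le> - p * (a + max (u - s) 0) powr (p - 1) * \<bar>(a + max (t' - s) 0) - (a + max (t - s) 0)\<bar>"
    unfolding shifted_power_def using assms by (intro powr_diff_le) auto
  also have "\<dots> \<le> - p * (a + max (u - s) 0) powr (p - 1) * (t' - t)"
    using assms by (intro mult_left_mono mult_nonneg_nonneg) auto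
  finally show ?thesis using True by (simp add: shifted_power_def mult_ac)
qed (use assms in \<open>simp add: shifted_power_future\<close>)

text \<open>
  Moving the base point multiplies \<open>a + (- s)\<^sub>+\<close> by a factor bounded away from zero, so that a single
  integrability condition at base point zero serves all base points.
\<close>

lemma shifted_power_change_base:
  assumes "a > 0" "p \<le> 0"
  shows "shifted_power a p u s \<le> (a / (a + \<bar>u\<bar>)) powr p * shifted_power a p 0 s"
proof -
  define y where "y = a + max (0 - s) 0"
  define c where "c = a / (a + \<bar>u\<bar>)"
  have c: "0 < c" "c \<le> 1" "c * (a + \<bar>u\<bar>) = a" using assms by (auto simp: c_def)
  have y: "a \<le> y" by (simp add: y_def)
  have "c * y \<le> a + max (u - s) 0"
  proof (cases "y \<le> a + \<bar>u\<bar>")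
    case True
    then have "c * y \<le> a" using c mult_left_mono[of y "a + \<bar>u\<bar>" c] by simp
    then show ?thesis by simp
  next
    case False
    have "(1 - c) * (a + \<bar>u\<bar>) \<le> (1 - c) * y" using False c by (intro mult_left_mono) auto
    then have "c * y \<le> y - \<bar>u\<bar>" using c by (simp add: algebra_simps)
    then show ?thesis using False by (auto simp: y_def max_def split: if_splits)
  qed
  then have "(a + max (u - s) 0) powr p \<le> (c * y) powr p"
    using c y assms by (intro powr_mono2') auto
  also have "\<dots> = c powr p * y powr p"
    by (rule powr_mult)
  finally show ?thesis by (simp add: shifted_power_def y_def c_def)
qed

lemma integrable_shifted_power:
  assumes "a > 0" "p < -1"
  shows "set_integrable lborel {..<v} (shifted_power a p u)"
proof -
  have 1: "set_integrable lborel {a..} (\<lambda>x. x powr p)"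
  proof -
    have "(\<lambda>x. x powr p) absolutely_integrable_on {a..}"
      using has_integral_powr_to_inf[OF assms(2,1)]
      by (intro nonnegative_absolutely_integrable_1) (auto simp: integrable_on_def)
    then show ?thesis
      unfolding set_integrable_def by (subst (asm) integrable_completion) auto
  qed
  have 2: "set_integrable lborel {..u} (shifted_power a p u)"
  proof -
    have "integrable lborel (\<lambda>s. indicator {a..} (a + u + (-1) * s) *\<^sub>R (a + u + (-1) * s) powr p)"
      using lborel_integrable_real_affine[OF 1[unfolded set_integrable_def], of "-1" "a + u"] by simp
    then show ?thesis unfolding set_integrable_def
      by (rule Bochner_Integration.integrable_cong[THEN iffD1, rotated 2])
        (auto simp: shifted_power_def max_def algebra_simps split: split_indicator)
  qed
  have 3: "set_integrable lborel {u..max u v} (shifted_power a p u)"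
    using continuous_on_shifted_power[OF assms(1)] by (intro borel_integrable_atLeastAtMost') auto
  show ?thesis
    using set_integrable_Un[OF 2 3] by (rule set_integrable_subset) auto
qed

lemma shifted_power_has_derivative:
  assumes "a > 0" "s \<noteq> t"
  shows "(shifted_power a p t has_real_derivative (- p * past_power a (p - 1) t s)) (at s)"
proof (cases "s < t")
  case True
  have "((\<lambda>s. (a + (t - s)) powr p) has_real_derivative (- p * (a + (t - s)) powr (p - 1))) (at s)"
    using True assms by (auto intro!: derivative_eq_intros)
  moreover have "eventually (\<lambda>s. (a + (t - s)) powr p = shifted_power a p t s) (nhds s)"
    using eventually_nhds_in_open[of "{..<t}" s] True by (auto simp: shifted_power_def elim!: eventually_mono)
  ultimately show ?thesis
    using True by (subst (asm) DERIV_cong_ev[OF refl _ refl]) (auto simp: past_power_def shifted_power_def)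
next
  case False
  then have "eventually (\<lambda>s. a powr p = shifted_power a p t s) (nhds s)"
    using eventually_nhds_in_open[of "{t<..}" s] assms(2) by (auto simp: shifted_power_def elim!: eventually_mono)
  moreover have "((\<lambda>s. a powr p) has_real_derivative 0) (at s)" by simp
  ultimately show ?thesis
    using False by (subst (asm) DERIV_cong_ev[OF refl _ refl]) (auto simp: past_power_def shifted_power_def)
qed

lemma has_integral_past_power:
  assumes "a > 0" "b \<le> c"
  shows "((\<lambda>s. p * past_power a (p - 1) t s) has_integral (shifted_power a p t b - shifted_power a p t c)) {b..c}"
proof -
  have "((\<lambda>s. - p * past_power a (p - 1) t s) has_integral (shifted_power a p t c - shifted_power a p t b)) {b..c}"
    using shifted_power_has_derivative[OF assms(1)] continuous_on_shifted_power[OF assms(1)] assms(2)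
    by (intro fundamental_theorem_of_calculus_interior_strong[of "{t}"])
       (auto simp: has_real_derivative_iff_has_vector_derivative)
  from has_integral_neg[OF this] show ?thesis by simp
qed

text \<open>
  The derivative of \<open>mvn_kernel a d t\<close> away from its kinks at \<open>0\<close> and \<open>t\<close>.
\<close>

definition kernel_slope :: "real \<Rightarrow> real \<Rightarrow> real \<Rightarrow> real \<Rightarrow> real" where
  "kernel_slope a d t s = d * (past_power a (d - 1) t s - past_power a (d - 1) 0 s)"

lemma measurable_kernel_slope [measurable]: "kernel_slope a d t \<in> borel_measurable borel"
  unfolding kernel_slope_def by measurable

text \<open>
  Stated for a general factor \<open>y\<close>: the constant \<open>1\<close> yields integrability of the slope itself, a path yields the
  existence of the pathwise integral and its Lipschitz bound.
\<close>

lemma past_power_diff_integral: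
  fixes y :: "real \<Rightarrow> real"
  assumes a: "a > 0" "p \<le> 0" and t: "u \<le> t" "t \<le> t'" and [measurable]: "y \<in> borel_measurable borel"
    and W: "set_integrable lborel {..<t'} (\<lambda>s. shifted_power a (p - 1) u s * y s)"
    and Y: "set_integrable lborel {t..<t'} y"
  shows "integrable lborel (\<lambda>s. (past_power a p t' s - past_power a p t s) * y s)" (is "integrable _ ?f")
    and "\<bar>LINT s|lborel. (past_power a p t' s - past_power a p t s) * y s\<bar> \<le>
      - p * (t' - t) * (LINT s:{..<t'}|lborel. \<bar>shifted_power a (p - 1) u s * y s\<bar>)
      + a powr p * (LINT s:{t..<t'}|lborel. \<bar>y s\<bar>)"
proof -
  let ?g = "\<lambda>s. - p * (t' - t) * (indicator {..<t'} s *\<^sub>R \<bar>shifted_power a (p - 1) u s * y s\<bar>)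
      + a powr p * (indicator {t..<t'} s *\<^sub>R \<bar>y s\<bar>)"
  have W': "integrable lborel (\<lambda>s. indicator {..<t'} s *\<^sub>R \<bar>shifted_power a (p - 1) u s * y s\<bar>)"
    and Y': "integrable lborel (\<lambda>s. indicator {t..<t'} s *\<^sub>R \<bar>y s\<bar>)"
    using set_integrable_abs[OF W] set_integrable_abs[OF Y] by (simp_all add: set_integrable_def)
  have g: "integrable lborel ?g"
    using W' Y' by (intro Bochner_Integration.integrable_add integrable_mult_right)
  have le: "\<bar>?f s\<bar> \<le> ?g s" for s
  proof -
    have "\<bar>?f s\<bar> \<le> (- p * (t' - t) * (indicator {..<t'} s * shifted_power a (p - 1) u s)
        + a powr p * indicator {t..<t'} s) * \<bar>y s\<bar>"
      unfolding abs_mult using past_power_diff_le[OF a t] by (intro mult_right_mono) auto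
    also have "\<dots> = ?g s" by (simp add: algebra_simps abs_mult)
    finally show ?thesis .
  qed
  show f: "integrable lborel ?f"
    by (rule Bochner_Integration.integrable_bound[OF g]) (use le in \<open>auto intro!: AE_I2 order_trans[OF le]\<close>)
  have "\<bar>integral\<^sup>L lborel ?f\<bar> \<le> (LINT s|lborel. \<bar>?f s\<bar>)"
    using integral_norm_bound[of lborel ?f] by simp
  also have "\<dots> \<le> integral\<^sup>L lborel ?g"
    using le f g by (intro integral_mono) auto
  also have "\<dots> = - p * (t' - t) * (LINT s:{..<t'}|lborel. \<bar>shifted_power a (p - 1) u s * y s\<bar>)
      + a powr p * (LINT s:{t..<t'}|lborel. \<bar>y s\<bar>)"
    unfolding set_lebesgue_integral_def
    using W' Y' by (subst Bochner_Integration.integral_add) auto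
  finally show "\<bar>integral\<^sup>L lborel ?f\<bar> \<le> \<dots>" .
qed

lemma riemann_integrand_eq:
  assumes "(\<lambda>s. X s \<omega>) = x"
  shows "riemann_integrand a d X t \<omega> = (\<lambda>s. (shifted_power a (d - 1) 0 s - shifted_power a (d - 1) t s) * x s)"
  using fun_cong[OF assms] by (intro ext) (simp add: riemann_integrand_def shifted_power_def)

lemma mvn_kernel_eq: "mvn_kernel a d t s = shifted_power a d 0 s - shifted_power a d t s"
  by (simp add: mvn_kernel_def shifted_power_def)

lemma measurable_mvn_kernel [measurable]: "mvn_kernel a d t \<in> borel_measurable borel"
  unfolding mvn_kernel_eq[abs_def] by measurable

lemma mvn_kernel_bound:
  assumes "a > 0" "d < 0"
  shows "\<bar>mvn_kernel a d t s\<bar> \<le>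
    - d * \<bar>t\<bar> * (indicator {..<max 0 t} s * shifted_power a (d - 1) (min 0 t) s)"
  using shifted_power_diff_le[of a d t t 0 s] shifted_power_diff_le[of a d 0 0 t s] assms
  by (cases "0 \<le> t") (auto simp: mvn_kernel_eq abs_minus_commute)

lemma kernel_slope_integrable:
  assumes "a > 0" "d < 0"
  shows "integrable lborel (kernel_slope a d t)"
proof -
  have *: "integrable lborel (\<lambda>s. (past_power a (d - 1) t' s - past_power a (d - 1) r s) * 1)" if "r \<le> t'" for r t'
  proof (rule past_power_diff_integral(1))
    show "set_integrable lborel {..<t'} (\<lambda>s. shifted_power a (d - 1 - 1) r s * 1)"
      using integrable_shifted_power[of a "d - 2"] assms by simp
    show "set_integrable lborel {r..<t'} (\<lambda>s. 1::real)"
      by (rule set_integrable_subset[OF borel_integrable_atLeastAtMost'[of r t']]) auto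
  qed (use assms that in auto)
  show ?thesis
    using integrable_mult_right[OF *[of 0 t], of d] integrable_mult_right[OF *[of t 0], of "- d"]
    by (cases "0 \<le> t") (simp_all add: kernel_slope_def[abs_def] algebra_simps)
qed

lemma kernel_slope_future: "max 0 t \<le> s \<Longrightarrow> kernel_slope a d t s = 0"
  by (simp add: kernel_slope_def past_power_def)

text \<open>
  The fundamental theorem of calculus on \<open>{s..b}\<close> for a point \<open>b\<close> beyond which both kernel and slope vanish.
\<close>

lemma mvn_kernel_eq_integral:
  assumes "a > 0" "d < 0"
  shows "mvn_kernel a d t s = - (LINT r|lborel. kernel_slope a d t r * indicator {s<..} r)"
proof -
  define b where "b = max s (max 0 t)"
  have b: "s \<le> b" "0 \<le> b" "t \<le> b" by (auto simp: b_def)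
  have "((\<lambda>r. d * past_power a (d - 1) t r - d * past_power a (d - 1) 0 r) has_integral
      (shifted_power a d t s - shifted_power a d t b) - (shifted_power a d 0 s - shifted_power a d 0 b)) {s..b}"
    using assms b by (intro has_integral_diff has_integral_past_power) auto
  then have "(kernel_slope a d t has_integral - mvn_kernel a d t s) {s..b}"
    using b by (simp add: mvn_kernel_eq shifted_power_future kernel_slope_def[abs_def] right_diff_distrib)
  moreover have "set_integrable lborel {s..b} (kernel_slope a d t)"
    using kernel_slope_integrable[OF assms] unfolding set_integrable_def
    by (intro integrable_mult_indicator) auto
  ultimately have "(LINT r:{s..b}|lborel. kernel_slope a d t r) = - mvn_kernel a d t s"
    by (metis set_borel_integral_eq_integral(2) integral_unique)
  moreover have "(LINT r:{s..b}|lborel. kernel_slope a d t r) = (LINT r|lborel. kernel_slope a d t r * indicator {s<..} r)"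
    unfolding set_lebesgue_integral_def
  proof (rule integral_cong_AE)
    show "AE r in lborel. indicat_real {s..b} r *\<^sub>R kernel_slope a d t r = kernel_slope a d t r * indicator {s<..} r"
      using AE_lborel_singleton[of s]
    proof eventually_elim
      case (elim r)
      then show ?case
        using kernel_slope_future[of t r a d] b by (cases "r \<le> b") (auto split: split_indicator)
    qed
  qed auto
  ultimately show ?thesis by simp
qed

lemma mvn_kernel_tendsto_0:
  assumes "a > 0" "d < 0"
  shows "(mvn_kernel a d t \<longlongrightarrow> 0) at_bot"
proof -
  have "(shifted_power a d t \<longlongrightarrow> 0) at_bot" for t
    unfolding shifted_power_def
  proof (rule tendsto_neg_powr[OF assms(2)])
    have "filterlim (\<lambda>s. (a + t) + - s) at_top at_bot"
      by (rule filterlim_tendsto_add_at_top[OF tendsto_const filterlim_uminus_at_top_at_bot])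
    then show "filterlim (\<lambda>s. a + max (t - s) 0) at_top at_bot"
      by (rule filterlim_at_top_mono) auto
  qed
  from tendsto_diff[OF this[of 0] this[of t]] show ?thesis by (simp add: mvn_kernel_eq[abs_def])
qed

text \<open>
  The kernel vanishes at both ends of the real line.  This is why no boundary term survives the integration by parts.
\<close>

lemma integral_kernel_slope:
  assumes "a > 0" "d < 0"
  shows "(LINT r|lborel. kernel_slope a d t r) = 0"
proof -
  have "(\<lambda>n. LINT r|lborel. kernel_slope a d t r * indicator {- real n<..} r) \<longlonglongrightarrow> (LINT r|lborel. kernel_slope a d t r)"
  proof (rule integral_dominated_convergence[where w = "\<lambda>r. \<bar>kernel_slope a d t r\<bar>"])
    show "AE r in lborel. (\<lambda>n. kernel_slope a d t r * indicator {- real n<..} r) \<longlonglongrightarrow> kernel_slope a d t r"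
    proof (intro AE_I2 tendsto_eventually)
      fix r
      have "eventually (\<lambda>n. - r < real n) sequentially"
        using filterlim_real_sequentially by (simp add: filterlim_at_top_dense)
      then show "eventually (\<lambda>n. kernel_slope a d t r * indicator {- real n<..} r = kernel_slope a d t r) sequentially"
        by eventually_elim auto
    qed
  qed (use kernel_slope_integrable[OF assms] in \<open>auto split: split_indicator\<close>)
  moreover have "(\<lambda>n. - mvn_kernel a d t (- real n)) \<longlonglongrightarrow> - 0"
    by (intro tendsto_minus filterlim_compose[OF mvn_kernel_tendsto_0[OF assms]]
        filterlim_compose[OF filterlim_uminus_at_bot_at_top filterlim_real_sequentially])
  ultimately show ?thesis
    using LIMSEQ_unique by (simp add: mvn_kernel_eq_integral[OF assms])
qed

section \<open>Pathwise integration by parts\<close>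

lemma set_integral_Ico_eq_Icc:
  fixes f :: "real \<Rightarrow> real"
  assumes [measurable]: "f \<in> borel_measurable borel"
  shows "(LINT s:{u..<v}|lborel. f s) = (LINT s:{u..v}|lborel. f s)"
  unfolding set_lebesgue_integral_def
  by (rule integral_cong_AE)
    (use AE_lborel_singleton[of v] in \<open>auto split: split_indicator elim!: eventually_mono\<close>)

text \<open>
  The properties of a single path that the integration by parts needs.  The weight decays like \<open>kernel_slope\<close>
  at minus infinity.
\<close>

locale tempered_path =
  fixes a d :: real and x :: "real \<Rightarrow> real"
  assumes a_pos: "0 < a" and d_neg: "d < 0" and mono: "mono x" and zero: "x 0 = 0"
    and tail: "set_integrable lborel {..0} (\<lambda>s. shifted_power a (d - 2) 0 s * x s)"
begin

lemma measurable_path [measurable]: "x \<in> borel_measurable borel"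
  using mono by (rule borel_measurable_mono)

lemma path_bound: "\<lbrakk>u \<le> s; s \<le> v\<rbrakk> \<Longrightarrow> \<bar>x s\<bar> \<le> \<bar>x u\<bar> + \<bar>x v\<bar>"
  using monoD[OF mono, of u s] monoD[OF mono, of s v] by linarith

lemma path_integrable_Icc: "set_integrable lborel {u..v} x"
proof (rule set_integrable_bound)
  show "set_integrable lborel {u..v} (\<lambda>_. \<bar>x u\<bar> + \<bar>x v\<bar>)"
    by (intro borel_integrable_atLeastAtMost') auto
  show "set_borel_measurable lborel {u..v} x"
    unfolding set_borel_measurable_def by measurable
qed (auto dest: path_bound)

lemma path_integrable_Ico: "set_integrable lborel {u..<v} x"
  using path_integrable_Icc[of u v] by (rule set_integrable_subset) auto

lemma weighted_path_integrable:
  "set_integrable lborel {..<v} (\<lambda>s. shifted_power a (d - 2) u s * x s)" (is "set_integrable _ _ ?f")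
proof -
  have m: "set_borel_measurable lborel A ?f" if "A \<in> sets borel" for A
    using that unfolding set_borel_measurable_def by measurable
  have 1: "set_integrable lborel {..0} ?f"
  proof (rule set_integrable_bound)
    show "set_integrable lborel {..0}
        (\<lambda>s. (a / (a + \<bar>u\<bar>)) powr (d - 2) * (shifted_power a (d - 2) 0 s * x s))"
      using tail by (rule set_integrable_mult_right)
    show "AE s in lborel. s \<in> {..0} \<longrightarrow> norm (?f s) \<le>
        norm ((a / (a + \<bar>u\<bar>)) powr (d - 2) * (shifted_power a (d - 2) 0 s * x s))"
    proof (intro AE_I2 impI)
      fix s
      have "shifted_power a (d - 2) u s * \<bar>x s\<bar>
          \<le> (a / (a + \<bar>u\<bar>)) powr (d - 2) * shifted_power a (d - 2) 0 s * \<bar>x s\<bar>"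
        using shifted_power_change_base[of a "d - 2"] a_pos d_neg by (intro mult_right_mono) auto
      then show "norm (?f s) \<le> norm ((a / (a + \<bar>u\<bar>)) powr (d - 2) * (shifted_power a (d - 2) 0 s * x s))"
        by (simp add: abs_mult mult.assoc)
    qed
  qed (use m in auto)
  have 2: "set_integrable lborel {0..max 0 v} ?f"
  proof (rule set_integrable_bound)
    show "set_integrable lborel {0..max 0 v} (\<lambda>s. a powr (d - 2) * x s)"
      using path_integrable_Icc by (rule set_integrable_mult_right)
  qed (use m a_pos d_neg in \<open>auto simp: abs_mult intro!: mult_right_mono shifted_power_le\<close>)
  show ?thesis
    using set_integrable_Un[OF 1 2] by (rule set_integrable_subset) auto
qed

lemma past_power_diff_path_integrable:
  "integrable lborel (\<lambda>s. (past_power a (d - 1) t' s - past_power a (d - 1) t s) * x s)"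
proof -
  have *: "integrable lborel (\<lambda>s. (past_power a (d - 1) t' s - past_power a (d - 1) t s) * x s)"
    if "t \<le> t'" for t t'
  proof (rule past_power_diff_integral(1))
  qed (use a_pos d_neg that weighted_path_integrable path_integrable_Ico in auto)
  show ?thesis
  proof (cases "t \<le> t'")
    case False
    then have "integrable lborel (\<lambda>s. - ((past_power a (d - 1) t s - past_power a (d - 1) t' s) * x s))"
      using * by (intro Bochner_Integration.integrable_minus) auto
    then show ?thesis by (simp add: algebra_simps)
  qed (rule *)
qed

lemma kernel_slope_path_integrable: "integrable lborel (\<lambda>s. kernel_slope a d t s * x s)"
  using integrable_mult_right[OF past_power_diff_path_integrable[of t 0], of d]
  by (simp add: kernel_slope_def mult.assoc)

definition path_integral :: "real \<Rightarrow> real" where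
  "path_integral t = - (LINT s|lborel. kernel_slope a d t s * x s)"

text \<open>
  Enlarging the weight from base point \<open>t\<close> to base point \<open>u\<close>, and the domain from \<open>{..<t'}\<close> to \<open>{..<v}\<close>, makes the
  constant uniform over \<open>{u..v}\<close>.
\<close>

lemma path_integral_lipschitz:
  "\<exists>L. \<forall>t t'. u \<le> t \<longrightarrow> t \<le> t' \<longrightarrow> t' \<le> v \<longrightarrow> \<bar>path_integral t' - path_integral t\<bar> \<le> L * (t' - t)"
proof -
  define W where "W = (LINT s:{..<v}|lborel. \<bar>shifted_power a (d - 2) u s * x s\<bar>)"
  define B where "B = \<bar>x u\<bar> + \<bar>x v\<bar>"
  have "\<bar>path_integral t' - path_integral t\<bar> \<le> - d * ((1 - d) * W + a powr (d - 1) * B) * (t' - t)"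
    if t: "u \<le> t" "t \<le> t'" "t' \<le> v" for t t'
  proof -
    let ?D = "\<lambda>s. (past_power a (d - 1) t' s - past_power a (d - 1) t s) * x s"
    have "path_integral t' - path_integral t = (LINT s|lborel. kernel_slope a d t s * x s - kernel_slope a d t' s * x s)"
      unfolding path_integral_def using kernel_slope_path_integrable by simp
    also have "\<dots> = (LINT s|lborel. - d * ?D s)"
      by (intro Bochner_Integration.integral_cong) (simp_all add: kernel_slope_def algebra_simps)
    also have "\<dots> = - d * integral\<^sup>L lborel ?D" by simp
    finally have eq: "\<bar>path_integral t' - path_integral t\<bar> = - d * \<bar>integral\<^sup>L lborel ?D\<bar>"
      using d_neg by (simp add: abs_mult)
    have "\<bar>integral\<^sup>L lborel ?D\<bar> \<le> - (d - 1) * (t' - t) * (LINT s:{..<t'}|lborel. \<bar>shifted_power a (d - 1 - 1) u s * x s\<bar>)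
      + a powr (d - 1) * (LINT s:{t..<t'}|lborel. \<bar>x s\<bar>)"
      using a_pos d_neg t path_integrable_Ico weighted_path_integrable by (intro past_power_diff_integral(2)) auto
    also have "\<dots> \<le> - (d - 1) * (t' - t) * W + a powr (d - 1) * (B * (t' - t))"
    proof (intro add_mono mult_left_mono)
      have i: "set_integrable lborel {..<v} (\<lambda>s. \<bar>shifted_power a (d - 2) u s * x s\<bar>)"
        using weighted_path_integrable by (rule set_integrable_abs)
      have "set_integrable lborel {..<t'} (\<lambda>s. \<bar>shifted_power a (d - 2) u s * x s\<bar>)"
        using i by (rule set_integrable_subset) (use t in auto)
      then show "(LINT s:{..<t'}|lborel. \<bar>shifted_power a (d - 1 - 1) u s * x s\<bar>) \<le> W"
        unfolding W_def set_lebesgue_integral_def using i t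
        by (intro integral_mono) (auto simp: set_integrable_def split: split_indicator)
      have "(LINT s:{t..<t'}|lborel. \<bar>x s\<bar>) \<le> (LINT s:{t..<t'}|lborel. B)"
      proof (rule set_integral_mono)
        show "set_integrable lborel {t..<t'} (\<lambda>_. B)"
          by (rule set_integrable_subset[OF borel_integrable_atLeastAtMost'[of t t']]) auto
        show "\<bar>x s\<bar> \<le> B" if "s \<in> {t..<t'}" for s
          using that t path_bound[of u s v] by (auto simp: B_def)
      qed (use path_integrable_Ico in \<open>auto intro: set_integrable_abs\<close>)
      also have "\<dots> = B * (t' - t)"
        using t by (simp add: set_lebesgue_integral_def)
      finally show "(LINT s:{t..<t'}|lborel. \<bar>x s\<bar>) \<le> B * (t' - t)" .
    qed (use d_neg t in auto)
    finally have "- d * \<bar>integral\<^sup>L lborel ?D\<bar> \<le> - d * (- (d - 1) * (t' - t) * W + a powr (d - 1) * (B * (t' - t)))"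
      using d_neg by (intro mult_left_mono) auto
    also have "\<dots> = - d * ((1 - d) * W + a powr (d - 1) * B) * (t' - t)" by algebra
    finally show ?thesis unfolding eq .
  qed
  then show ?thesis by blast
qed

lemma continuous_path_integral: "continuous_on UNIV path_integral"
proof (rule continuous_at_imp_continuous_on, intro ballI)
  fix t :: real
  obtain L where L: "\<And>r r'. \<lbrakk>t - 1 \<le> r; r \<le> r'; r' \<le> t + 1\<rbrakk> \<Longrightarrow> \<bar>path_integral r' - path_integral r\<bar> \<le> L * (r' - r)"
    using path_integral_lipschitz[of "t - 1" "t + 1"] by blast
  have "\<bar>path_integral s - path_integral t\<bar> \<le> L * \<bar>s - t\<bar>" if "\<bar>s - t\<bar> \<le> 1" for s
    using L[of s t] L[of t s] that by (cases "s \<le> t") (auto simp: abs_minus_commute abs_le_iff)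
  then have "eventually (\<lambda>s. norm (path_integral s - path_integral t) \<le> L * \<bar>s - t\<bar>) (at t)"
    unfolding eventually_at by (intro exI[of _ 1]) (auto simp: dist_real_def)
  moreover have "((\<lambda>s. L * \<bar>s - t\<bar>) \<longlongrightarrow> 0) (at t)"
    by (auto intro!: tendsto_eq_intros)
  ultimately have "((\<lambda>s. path_integral s - path_integral t) \<longlongrightarrow> 0) (at t)"
    by (rule Lim_null_comparison)
  then show "isCont path_integral t"
    unfolding isCont_def by (simp add: LIM_zero_iff)
qed

lemma finite_variation_path_integral: "finite_variation_on path_integral u v"
proof -
  obtain L where L: "\<And>r r'. \<lbrakk>u \<le> r; r \<le> r'; r' \<le> v\<rbrakk> \<Longrightarrow> \<bar>path_integral r' - path_integral r\<bar> \<le> L * (r' - r)"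
    using path_integral_lipschitz[of u v] by blast
  have "(\<Sum>i<n. \<bar>path_integral (r (Suc i)) - path_integral (r i)\<bar>) \<le> \<bar>L\<bar> * (v - u)"
    if r: "u \<le> r 0" "\<forall>i<n. r i \<le> r (Suc i)" "r n \<le> v" for n and r :: "nat \<Rightarrow> real"
  proof -
    have ord: "r i \<le> r j" if "i \<le> j" "j \<le> n" for i j
      using that
    proof (induction rule: dec_induct)
      case (step k)
      then show ?case using r(2)[rule_format, of k] by simp
    qed simp
    have "(\<Sum>i<n. \<bar>path_integral (r (Suc i)) - path_integral (r i)\<bar>) \<le> (\<Sum>i<n. L * (r (Suc i) - r i))"
    proof (intro sum_mono L)
      fix i assume i: "i \<in> {..<n}"
      show "u \<le> r i" using ord[of 0 i] r(1) i by simp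
      show "r i \<le> r (Suc i)" using r(2) i by simp
      show "r (Suc i) \<le> v" using ord[of "Suc i" n] r(3) i by simp
    qed
    also have "\<dots> = L * (r n - r 0)"
      by (simp add: sum_distrib_left[symmetric] sum_lessThan_telescope)
    also have "\<dots> \<le> \<bar>L\<bar> * (v - u)"
      using r ord[of 0 n] by (intro mult_mono) auto
    finally show ?thesis .
  qed
  then show ?thesis unfolding finite_variation_on_def by blast
qed

lemma has_riemann_integral_path:
  assumes "u \<le> v"
  shows "has_riemann_integral x u v (LINT s:{u..v}|lborel. x s)"
proof -
  note int = set_borel_integral_eq_integral[OF path_integrable_Icc[of u v]]
  have "has_riemann_integral x u v (integral {u..v} x)"
    using assms int monoD[OF mono] by (intro has_riemann_integral_bounded_variation[where V = x]) auto
  then show ?thesis unfolding int(2) .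
qed

text \<open>
  Half-open intervals make the signed interval between \<open>0\<close> and \<open>t\<close> equal to the difference of the
  indicator functions of \<open>{0..}\<close> and \<open>{t..}\<close>, pointwise and for either sign of \<open>t\<close>.
\<close>

lemma riemann_integral_path:
  "riemann_integral x 0 t = (LINT s|lborel. (indicator {0..<t} s - indicator {t..<0} s) * x s)"
proof (cases "0 \<le> t")
  case True
  have "(LINT s|lborel. (indicator {0..<t} s - indicator {t..<0} s) * x s) = (LINT s:{0..<t}|lborel. x s)"
    using True by (simp add: set_lebesgue_integral_def)
  then show ?thesis
    using True riemann_integral_eqI[OF has_riemann_integral_path[of 0 t]]
    by (simp add: riemann_integral_def set_integral_Ico_eq_Icc)
next
  case False
  have "(LINT s|lborel. (indicator {0..<t} s - indicator {t..<0} s) * x s) = - (LINT s:{t..<0}|lborel. x s)"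
    using False by (simp add: set_lebesgue_integral_def)
  then show ?thesis
    using False riemann_integral_eqI[OF has_riemann_integral_path[of t 0]]
    by (simp add: riemann_integral_def set_integral_Ico_eq_Icc)
qed

text \<open>
  Up to a constant factor, the kernel of the improper integral differs from the slope only by a bounded term between \<open>0\<close> and \<open>t\<close>.  That term
  accounts for the integral from \<open>0\<close> to \<open>t\<close> in the representation, the two indicator functions encoding its sign.
\<close>

lemma shifted_power_diff_path:
  "(shifted_power a (d - 1) 0 s - shifted_power a (d - 1) t s) * x s =
    (past_power a (d - 1) 0 s - past_power a (d - 1) t s) * x s
    + a powr (d - 1) * ((indicator {0..<t} s - indicator {t..<0} s) * x s)"
proof -
  have split: "shifted_power a (d - 1) t s = past_power a (d - 1) t s + a powr (d - 1) * indicator {t..} s" for t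
    by (cases "s < t") (simp_all add: past_power_def shifted_power_future)
  have "indicator {0..} s - indicator {t..} s = (indicator {0..<t} s - indicator {t..<0} s :: real)"
    by (simp split: split_indicator)
  then show ?thesis unfolding split by algebra
qed

lemma signed_interval_path_integrable:
  "integrable lborel (\<lambda>s. (indicator {0..<t} s - indicator {t..<0} s) * x s)"
  using Bochner_Integration.integrable_diff[OF path_integrable_Ico[of 0 t, unfolded set_integrable_def]
      path_integrable_Ico[of t 0, unfolded set_integrable_def]]
  by (simp add: left_diff_distrib)

lemma shifted_power_diff_path_integrable:
  "integrable lborel (\<lambda>s. (shifted_power a (d - 1) 0 s - shifted_power a (d - 1) t s) * x s)"
  unfolding shifted_power_diff_path
  by (intro Bochner_Integration.integrable_add past_power_diff_path_integrable
      integrable_mult_right signed_interval_path_integrable)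

text \<open>
  The integrand is a difference of increasing functions times an increasing function; by the product rule its
  oscillation is dominated by the increment of an increasing function.
\<close>

lemma has_riemann_integral_shifted_power_diff:
  assumes uv: "u \<le> v"
  shows "has_riemann_integral (\<lambda>s. (shifted_power a (d - 1) 0 s - shifted_power a (d - 1) t s) * x s) u v
    (LINT s:{u..v}|lborel. (shifted_power a (d - 1) 0 s - shifted_power a (d - 1) t s) * x s)"
proof -
  define k0 where "k0 = shifted_power a (d - 1) 0"
  define k1 where "k1 = shifted_power a (d - 1) t"
  define B where "B = \<bar>x u\<bar> + \<bar>x v\<bar>"
  define C where "C = a powr (d - 1)"
  let ?f = "\<lambda>s. (k0 s - k1 s) * x s"
  have si: "set_integrable lborel {u..v} ?f"
    using shifted_power_diff_path_integrable[of t] unfolding set_integrable_def k0_def k1_def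
    by (intro integrable_mult_indicator) auto
  note int = set_borel_integral_eq_integral[OF si]
  have "has_riemann_integral ?f u v (integral {u..v} ?f)"
  proof (rule has_riemann_integral_bounded_variation[where V = "\<lambda>s. B * (k0 s + k1 s) + C * x s"])
    fix y z assume yz: "u \<le> y" "y \<le> z" "z \<le> v"
    have mk: "k0 y \<le> k0 z" "k1 y \<le> k1 z" and mx: "x y \<le> x z"
      using monoD[OF mono_shifted_power, of a "d - 1" y z] monoD[OF mono, of y z] a_pos d_neg yz
      by (auto simp: k0_def k1_def)
    have k: "\<bar>k0 y - k1 y\<bar> \<le> C"
      using shifted_power_le[of a "d - 1" 0 y] shifted_power_le[of a "d - 1" t y]
        shifted_power_nonneg[of a "d - 1" 0 y] shifted_power_nonneg[of a "d - 1" t y] a_pos d_neg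
      unfolding k0_def k1_def C_def by linarith
    have "?f z - ?f y = ((k0 z - k0 y) - (k1 z - k1 y)) * x z + (k0 y - k1 y) * (x z - x y)"
      by (simp add: algebra_simps)
    also have "\<bar>\<dots>\<bar> \<le> \<bar>(k0 z - k0 y) - (k1 z - k1 y)\<bar> * \<bar>x z\<bar> + \<bar>k0 y - k1 y\<bar> * \<bar>x z - x y\<bar>"
      by (metis abs_mult abs_triangle_ineq)
    also have "\<dots> \<le> ((k0 z - k0 y) + (k1 z - k1 y)) * B + C * (x z - x y)"
      using mk mx k path_bound[of u z v] yz by (intro add_mono mult_mono) (auto simp: B_def)
    finally show "\<bar>?f z - ?f y\<bar> \<le> (B * (k0 z + k1 z) + C * x z) - (B * (k0 y + k1 y) + C * x y)"
      by (simp add: algebra_simps)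
  qed (use int uv in auto)
  then show ?thesis unfolding int(2)[symmetric] unfolding k0_def k1_def .
qed

text \<open>
  Absolute integrability over the line lets the two limits of integration go to infinity independently of each other.
\<close>

lemma has_improper_riemann_integral_shifted_power_diff:
  "has_improper_riemann_integral (\<lambda>s. (shifted_power a (d - 1) 0 s - shifted_power a (d - 1) t s) * x s)
    (LINT s|lborel. (shifted_power a (d - 1) 0 s - shifted_power a (d - 1) t s) * x s)"
  (is "has_improper_riemann_integral ?f ?I")
  unfolding has_improper_riemann_integral_def
proof (intro conjI allI impI)
  show "riemann_integrable ?f u v" if "u \<le> v" for u v
    using has_riemann_integral_shifted_power_diff[OF that] by (auto simp: riemann_integrable_def)
  note int = shifted_power_diff_path_integrable[of t]
  have si: "set_integrable lborel A ?f" if "A \<in> sets borel" for A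
    using int that unfolding set_integrable_def by (intro integrable_mult_indicator) auto
  have left: "((\<lambda>u. LINT s:{u..0}|lborel. ?f s) \<longlongrightarrow> (LINT s:{..0}|lborel. ?f s)) at_bot"
    by (intro tendsto_set_lebesgue_integral_at_bot si) auto
  have right: "((\<lambda>v. LINT s:{0..v}|lborel. ?f s) \<longlongrightarrow> (LINT s:{0..}|lborel. ?f s)) at_top"
    by (intro tendsto_set_lebesgue_integral_at_top si) auto
  have ae0: "AE s in lborel. \<not> (s \<in> {u..0::real} \<and> s \<in> {0..v})"
    "AE s in lborel. \<not> (s \<in> {..0::real} \<and> s \<in> {0..})" for u v
    using AE_lborel_singleton[of "0::real"] by (auto elim!: eventually_mono)
  have total: "?I = (LINT s:{..0}|lborel. ?f s) + (LINT s:{0..}|lborel. ?f s)"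
  proof -
    have "{..0::real} \<union> {0..} = UNIV" by auto
    then have "(LINT s:{..0} \<union> {0..}|lborel. ?f s) = ?I"
      by (simp add: set_lebesgue_integral_def)
    then show ?thesis
      using ae0 by (subst (asm) set_integral_Un_AE) (auto intro: si)
  qed
  have "((\<lambda>(u, v). (LINT s:{u..0}|lborel. ?f s) + (LINT s:{0..v}|lborel. ?f s)) \<longlongrightarrow> ?I) (at_bot \<times>\<^sub>F at_top)"
    unfolding total case_prod_unfold
    by (intro tendsto_add filterlim_compose[OF left] filterlim_compose[OF right] filterlim_fst filterlim_snd)
  moreover have "eventually (\<lambda>p. (case p of (u, v) \<Rightarrow> (LINT s:{u..0}|lborel. ?f s) + (LINT s:{0..v}|lborel. ?f s))
      = (case p of (u, v) \<Rightarrow> riemann_integral ?f u v)) (at_bot \<times>\<^sub>F at_top)"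
  proof (rule eventually_prodI[THEN eventually_mono])
    show "eventually (\<lambda>u. u \<le> (0::real)) at_bot" "eventually (\<lambda>v. (0::real) \<le> v) at_top"
      by (rule eventually_le_at_bot eventually_ge_at_top)+
    fix p :: "real \<times> real" assume p: "fst p \<le> 0 \<and> 0 \<le> snd p"
    obtain u v where uv: "p = (u, v)" "u \<le> 0" "0 \<le> v" using p by (cases p) auto
    have "{u..v} = {u..0} \<union> {0..v}" using uv by auto
    then have "(LINT s:{u..v}|lborel. ?f s) = (LINT s:{u..0}|lborel. ?f s) + (LINT s:{0..v}|lborel. ?f s)"
      using ae0 by (simp only:) (subst set_integral_Un_AE, auto intro: si)
    then show "(case p of (u, v) \<Rightarrow> (LINT s:{u..0}|lborel. ?f s) + (LINT s:{0..v}|lborel. ?f s))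
        = (case p of (u, v) \<Rightarrow> riemann_integral ?f u v)"
      using uv riemann_integral_eqI[OF has_riemann_integral_shifted_power_diff[of u v t]]
      by (simp add: riemann_integral_def)
  qed
  ultimately show "((\<lambda>(u, v). riemann_integral ?f u v) \<longlongrightarrow> ?I) (at_bot \<times>\<^sub>F at_top)"
    by (rule Lim_transform_eventually)
qed

lemma riemann_representation_eq_path_integral:
  assumes X: "(\<lambda>s. X s \<omega>) = x"
  shows "riemann_representation a d X t \<omega> = path_integral t"
proof -
  let ?p = "past_power a (d - 1)"
  let ?J = "\<lambda>s. (indicator {0..<t} s - indicator {t..<0} s) * x s"
  have "riemann_representation a d X t \<omega> =
      d * (LINT s|lborel. (?p 0 s - ?p t s) * x s + a powr (d - 1) * ?J s)
        - d * a powr (d - 1) * integral\<^sup>L lborel ?J"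
    unfolding riemann_representation_def riemann_integrand_eq[where X = X and \<omega> = \<omega>, OF X] X
      has_improper_riemann_integral_unique[OF has_improper_riemann_integral_shifted_power_diff]
    by (simp only: riemann_integral_path shifted_power_diff_path)
  also have "(LINT s|lborel. (?p 0 s - ?p t s) * x s + a powr (d - 1) * ?J s)
      = (LINT s|lborel. (?p 0 s - ?p t s) * x s) + a powr (d - 1) * integral\<^sup>L lborel ?J"
    using past_power_diff_path_integrable[of 0 t]
      integrable_mult_right[OF signed_interval_path_integrable[of t], of "a powr (d - 1)"]
    by (subst Bochner_Integration.integral_add) (assumption | rule refl integral_mult_right_zero arg_cong2[where f = "(+)"])+
  also have "d * \<dots> - d * a powr (d - 1) * integral\<^sup>L lborel ?J = d * (LINT s|lborel. (?p 0 s - ?p t s) * x s)"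
    by algebra
  also have "\<dots> = (LINT s|lborel. - (kernel_slope a d t s * x s))"
    by (subst integral_mult_right_zero[symmetric], rule Bochner_Integration.integral_cong)
      (auto simp: kernel_slope_def algebra_simps)
  also have "\<dots> = path_integral t" by (simp add: path_integral_def)
  finally show ?thesis .
qed

end

section \<open>Step functions on a uniform grid\<close>

definition grid_point :: "nat \<Rightarrow> nat \<Rightarrow> real" where
  "grid_point m k = real k / real m - real m"

definition grid_steps :: "(real \<Rightarrow> real) \<Rightarrow> nat \<Rightarrow> step" where
  "grid_steps f m = map (\<lambda>k. (f (grid_point m k), grid_point m k, grid_point m (Suc k))) [0..<2 * m * m]"

definition grid_index :: "nat \<Rightarrow> real \<Rightarrow> nat" where
  "grid_index m r = nat \<lceil>(r + m) * m\<rceil>"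

text \<open>
  The least grid point that is at least \<open>r\<close>, with \<open>r\<close> clamped to the range of the grid.
\<close>

definition grid_ceiling :: "nat \<Rightarrow> real \<Rightarrow> real" where
  "grid_ceiling m r = grid_point m (min (2 * m * m) (grid_index m r))"

lemma grid_point_less_iff:
  assumes "m > 0"
  shows "grid_point m k < r \<longleftrightarrow> k < grid_index m r"
proof -
  have "grid_point m k < r \<longleftrightarrow> real k < (r + m) * m"
    using assms by (simp add: grid_point_def field_simps)
  then show ?thesis
    by (simp add: grid_index_def zless_nat_eq_int_zless less_ceiling_iff)
qed

lemma grid_point_ends: "m > 0 \<Longrightarrow> grid_point m 0 = - real m" "m > 0 \<Longrightarrow> grid_point m (2 * m * m) = real m"
  by (simp_all add: grid_point_def)

lemma grid_point_mono: "k \<le> l \<Longrightarrow> grid_point m k \<le> grid_point m l"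
  by (simp add: grid_point_def divide_right_mono)

lemma grid_index_mono: "r \<le> s \<Longrightarrow> grid_index m r \<le> grid_index m s"
  unfolding grid_index_def by (intro nat_mono ceiling_mono mult_right_mono) auto

lemma grid_ceiling_mono: "r \<le> s \<Longrightarrow> grid_ceiling m r \<le> grid_ceiling m s"
  unfolding grid_ceiling_def using grid_index_mono[of r s m] by (intro grid_point_mono) auto

lemma grid_ceiling_grid_point:
  assumes "m > 0" "k \<le> 2 * m * m"
  shows "grid_ceiling m (grid_point m k) = grid_point m k"
proof -
  have "j < grid_index m (grid_point m k) \<longleftrightarrow> j < k" for j
    using assms(1) by (simp add: grid_point_less_iff[symmetric] grid_point_def divide_less_cancel)
  then have "grid_index m (grid_point m k) = k"
    by (metis less_irrefl nat_neq_iff)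
  then show ?thesis using assms by (simp add: grid_ceiling_def)
qed

lemma grid_ceiling_bounds:
  assumes m: "m > 0"
  shows "\<bar>grid_ceiling m r\<bar> \<le> m"
    and "r \<le> m \<Longrightarrow> r \<le> grid_ceiling m r"
    and "- real m \<le> r \<Longrightarrow> grid_ceiling m r \<le> r + 1 / m"
    and "r \<le> 0 \<Longrightarrow> grid_ceiling m r \<le> 0"
proof -
  show "\<bar>grid_ceiling m r\<bar> \<le> m"
    using grid_point_mono[of 0 "min (2 * m * m) (grid_index m r)" m]
      grid_point_mono[of "min (2 * m * m) (grid_index m r)" "2 * m * m" m] grid_point_ends[OF m]
    by (simp add: grid_ceiling_def)
  show "r \<le> grid_ceiling m r" if "r \<le> m"
  proof (cases "grid_index m r \<le> 2 * m * m")
    case True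
    then show ?thesis
      using grid_point_less_iff[OF m, of "grid_index m r" r] by (simp add: grid_ceiling_def)
  next
    case False
    then show ?thesis using that grid_point_ends[OF m] by (simp add: grid_ceiling_def)
  qed
  show "grid_ceiling m r \<le> r + 1 / m" if "- real m \<le> r"
  proof (cases "grid_index m r")
    case 0
    then have "grid_ceiling m r = - real m" by (simp add: grid_ceiling_def grid_point_def)
    moreover have "0 \<le> 1 / real m" by simp
    ultimately show ?thesis using that by linarith
  next
    case (Suc k)
    have "grid_ceiling m r \<le> grid_point m (Suc k)"
      unfolding grid_ceiling_def using Suc by (intro grid_point_mono) auto
    also have "\<dots> = grid_point m k + 1 / m" by (simp add: grid_point_def add_divide_distrib)
    also have "\<dots> \<le> r + 1 / m" using grid_point_less_iff[OF m, of k r] Suc by simp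
    finally show ?thesis .
  qed
  show "grid_ceiling m r \<le> 0" if "r \<le> 0"
  proof -
    have "grid_point m (m * m) = 0" using m by (simp add: grid_point_def)
    then show ?thesis
      using grid_ceiling_mono[OF that, of m] grid_ceiling_grid_point[OF m, of "m * m"] by simp
  qed
qed

lemma grid_ceiling_tendsto: "(\<lambda>n. grid_ceiling (Suc n) r) \<longlonglongrightarrow> r"
proof (rule tendsto_sandwich[where f = "\<lambda>_. r" and h = "\<lambda>n. r + 1 / real (Suc n)"])
  have ev: "eventually (\<lambda>n. \<bar>r\<bar> \<le> real (Suc n)) sequentially"
    using filterlim_compose[OF filterlim_real_sequentially filterlim_Suc] by (simp add: filterlim_at_top)
  show "eventually (\<lambda>n. r \<le> grid_ceiling (Suc n) r) sequentially"
    using ev by eventually_elim (rule grid_ceiling_bounds(2), auto)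
  show "eventually (\<lambda>n. grid_ceiling (Suc n) r \<le> r + 1 / real (Suc n)) sequentially"
    using ev by eventually_elim (rule grid_ceiling_bounds(3), auto)
  show "(\<lambda>n. r + 1 / real (Suc n)) \<longlonglongrightarrow> r"
    using tendsto_add[OF tendsto_const[of r] LIMSEQ_inverse_real_of_nat] by (simp add: inverse_eq_divide)
qed simp

lemma step_integral_grid:
  "step_integral X (grid_steps f m) \<omega> =
    (\<Sum>k<2 * m * m. f (grid_point m k) * (X (grid_point m (Suc k)) \<omega> - X (grid_point m k) \<omega>))"
  by (simp add: step_integral_def grid_steps_def comp_def interv_sum_list_conv_sum_set_nat atLeast0LessThan)

text \<open>
  The cells whose left end lies below \<open>r\<close> are the first \<open>grid_index m r\<close> ones, so the sum telescopes.
\<close>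

lemma grid_telescope:
  fixes x :: "real \<Rightarrow> real"
  assumes m: "m > 0"
  shows "(\<Sum>k<2 * m * m. indicator {grid_point m k<..} r * (x (grid_point m (Suc k)) - x (grid_point m k)))
    = x (grid_ceiling m r) - x (- real m)"
proof -
  define y where "y k = x (grid_point m k)" for k
  define N where "N = 2 * m * m"
  have "(\<Sum>k<N. indicator {grid_point m k<..} r * (y (Suc k) - y k))
      = (\<Sum>k<N. if k < grid_index m r then y (Suc k) - y k else 0)"
    by (intro sum.cong refl) (simp add: indicator_def grid_point_less_iff[OF m])
  also have "\<dots> = (\<Sum>k | k \<in> {..<N} \<and> k < grid_index m r. y (Suc k) - y k)"
    by (rule sum.inter_filter[symmetric]) simp
  also have "{k. k \<in> {..<N} \<and> k < grid_index m r} = {..<min N (grid_index m r)}" by auto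
  also have "(\<Sum>k\<in>\<dots>. y (Suc k) - y k) = y (min N (grid_index m r)) - y 0"
    by (rule sum_lessThan_telescope)
  finally show ?thesis
    by (simp only: y_def N_def grid_ceiling_def grid_point_ends[OF m])
qed

lemma step_fun_grid:
  assumes m: "m > 0"
  shows "step_fun (grid_steps f m) r =
    (if grid_index m r \<in> {1..2 * m * m} then f (grid_point m (grid_index m r - 1)) else 0)"
proof -
  have "step_fun (grid_steps f m) r
      = (\<Sum>k<2 * m * m. f (grid_point m k) * indicator {grid_point m k<..grid_point m (Suc k)} r)"
    by (simp add: step_fun_def grid_steps_def comp_def interv_sum_list_conv_sum_set_nat atLeast0LessThan)
  also have "\<dots> = (\<Sum>k<2 * m * m. if k = grid_index m r - 1 \<and> grid_index m r \<ge> 1 then f (grid_point m k) else 0)"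
  proof (rule sum.cong[OF refl])
    fix k
    show "f (grid_point m k) * indicator {grid_point m k<..grid_point m (Suc k)} r
        = (if k = grid_index m r - 1 \<and> grid_index m r \<ge> 1 then f (grid_point m k) else 0)"
      using grid_point_less_iff[OF m, of k r] grid_point_less_iff[OF m, of "Suc k" r]
      by (auto simp: not_less[symmetric] split: split_indicator)
  qed
  also have "\<dots> = (if grid_index m r \<in> {1..2 * m * m} then f (grid_point m (grid_index m r - 1)) else 0)"
    by (cases "grid_index m r \<ge> 1") (auto simp: sum.delta)
  finally show ?thesis .
qed

lemma measurable_step_fun [measurable]: "step_fun \<phi> \<in> borel_measurable borel"
proof (induction \<phi>)
  case (Cons p \<phi>)
  obtain c u v where p: "p = (c, u, v)" by (cases p)
  have "step_fun (p # \<phi>) = (\<lambda>s. c * indicator {u<..v} s + step_fun \<phi> s)"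
    by (simp add: step_fun_def p fun_eq_iff)
  then show ?case using Cons.IH by simp
qed (simp add: step_fun_def[abs_def])

text \<open>
  Dominated convergence.  The kernel is bounded by an increasing weight on the half line where it does not vanish, and
  the tag of a cell lies to the left of the cell by at most \<open>1\<close>, so that the weight, extended by one unit to the right,
  dominates all the step functions as well.  As this envelope is bounded by \<open>C\<close>, the same envelope serves in L2.
\<close>

lemma grid_steps_approximating:
  assumes a: "a > 0" and d: "d < 0"
  shows "approximating_steps (\<lambda>n. grid_steps (mvn_kernel a d t) (Suc n)) (mvn_kernel a d t)"
proof -
  let ?f = "mvn_kernel a d t"
  define u where "u = min 0 t"
  define v where "v = max 0 t"
  \<comment> \<open>The envelope of the kernel and of all its grid approximations.\<close>
  define E where "E = (\<lambda>s. - d * \<bar>t\<bar> * (indicator {..<v + 1} s * shifted_power a (d - 1) u s))"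
  define C where "C = - d * \<bar>t\<bar> * a powr (d - 1)"
  have [measurable]: "E \<in> borel_measurable borel" unfolding E_def by measurable
  have E: "0 \<le> E s" "E s \<le> C" for s
  proof -
    have 1: "0 \<le> - d * \<bar>t\<bar>" using d by (simp add: mult_nonpos_nonneg)
    have 2: "0 \<le> indicator {..<v + 1} s * shifted_power a (d - 1) u s" by simp
    have 3: "indicator {..<v + 1} s * shifted_power a (d - 1) u s \<le> a powr (d - 1)"
      using d shifted_power_le[OF a, of "d - 1" u s] by (cases "s < v + 1") auto
    show "0 \<le> E s" unfolding E_def by (rule mult_nonneg_nonneg[OF 1 2])
    show "E s \<le> C" unfolding E_def C_def by (rule mult_left_mono[OF 3 1])
  qed
  have C: "0 \<le> C" using E[of 0] by linarith
  have int_E: "integrable lborel E"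
    unfolding E_def using integrable_shifted_power[OF a, of "d - 1" "v + 1" u] d
    by (intro integrable_mult_right) (simp add: set_integrable_def)
  have fE: "\<bar>?f s\<bar> \<le> E r" if "s \<le> r" "r \<le> s + 1" for s r
  proof -
    have "\<bar>?f s\<bar> \<le> - d * \<bar>t\<bar> * (indicator {..<v} s * shifted_power a (d - 1) u s)"
      using mvn_kernel_bound[OF a d] by (simp add: u_def v_def)
    also have "indicator {..<v} s * shifted_power a (d - 1) u s \<le> indicator {..<v + 1} r * shifted_power a (d - 1) u r"
      using that d monoD[OF mono_shifted_power[OF a, of "d - 1" u] that(1)]
      by (auto split: split_indicator)
    finally show ?thesis using d by (simp add: E_def mult_left_mono)
  qed
  let ?g = "\<lambda>n. step_fun (grid_steps ?f (Suc n))"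
  have gE: "\<bar>?g n r\<bar> \<le> E r" for n r
  proof (cases "grid_index (Suc n) r \<in> {1..2 * Suc n * Suc n}")
    case True
    define k where "k = grid_index (Suc n) r - 1"
    have k: "grid_index (Suc n) r = Suc k" using True by (simp add: k_def)
    have "grid_point (Suc n) k < r" "r \<le> grid_point (Suc n) (Suc k)"
      using grid_point_less_iff[of "Suc n" k r] grid_point_less_iff[of "Suc n" "Suc k" r] k by auto
    moreover have "grid_point (Suc n) (Suc k) \<le> grid_point (Suc n) k + 1"
      by (simp add: grid_point_def field_simps)
    ultimately show ?thesis
      unfolding step_fun_grid[OF zero_less_Suc] if_P[OF True]
      using fE[of "grid_point (Suc n) k" r] by (simp add: k)
  next
    case False
    show ?thesis
      unfolding step_fun_grid[OF zero_less_Suc] if_not_P[OF False] using E(1)[of r] by simp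
  qed
  have lim: "(\<lambda>n. ?g n r) \<longlonglongrightarrow> ?f r" for r
  proof -
    have cont: "isCont ?f r"
      using continuous_on_diff[OF continuous_on_shifted_power[OF a] continuous_on_shifted_power[OF a], of UNIV d 0 d t]
      by (simp add: mvn_kernel_eq[abs_def] continuous_on_eq_continuous_at)
    have ev: "eventually (\<lambda>n. \<bar>r\<bar> < real (Suc n)) sequentially"
      using filterlim_compose[OF filterlim_real_sequentially filterlim_Suc] by (simp add: filterlim_at_top_dense)
    have idx: "grid_index (Suc n) r \<in> {1..2 * Suc n * Suc n}" if "\<bar>r\<bar> < real (Suc n)" for n
    proof -
      have "0 < grid_index (Suc n) r"
        using that unfolding grid_point_less_iff[OF zero_less_Suc, symmetric] grid_point_ends(1)[OF zero_less_Suc]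
        by linarith
      moreover have "\<not> 2 * Suc n * Suc n < grid_index (Suc n) r"
        using that unfolding grid_point_less_iff[OF zero_less_Suc, symmetric] grid_point_ends(2)[OF zero_less_Suc]
        by linarith
      ultimately show ?thesis unfolding atLeastAtMost_iff not_less by (simp only: Suc_le_eq One_nat_def)
    qed
    define p where "p n = grid_point (Suc n) (grid_index (Suc n) r - 1)" for n
    have "p \<longlonglongrightarrow> r"
    proof (rule tendsto_sandwich[where h = "\<lambda>_. r" and f = "\<lambda>n. r - 1 / real (Suc n)"])
      show "eventually (\<lambda>n. r - 1 / real (Suc n) \<le> p n) sequentially" using ev
      proof eventually_elim
        case (elim n)
        obtain k where k: "grid_index (Suc n) r = Suc k" using idx[OF elim] by (cases "grid_index (Suc n) r") auto
        have "r \<le> grid_point (Suc n) (Suc k)" using grid_point_less_iff[of "Suc n" "Suc k" r] k by auto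
        then show ?case by (simp add: p_def k grid_point_def add_divide_distrib)
      qed
      show "eventually (\<lambda>n. p n \<le> r) sequentially" using ev
      proof eventually_elim
        case (elim n)
        obtain k where k: "grid_index (Suc n) r = Suc k" using idx[OF elim] by (cases "grid_index (Suc n) r") auto
        then show ?case using grid_point_less_iff[of "Suc n" k r] by (simp add: p_def)
      qed
      show "(\<lambda>n. r - 1 / real (Suc n)) \<longlonglongrightarrow> r"
        using tendsto_diff[OF tendsto_const[of r] LIMSEQ_inverse_real_of_nat] by (simp add: inverse_eq_divide)
    qed simp
    then have "(\<lambda>n. ?f (p n)) \<longlonglongrightarrow> ?f r" by (rule isCont_tendsto_compose[OF cont])
    moreover have "eventually (\<lambda>n. ?f (p n) = ?g n r) sequentially"
      using ev by eventually_elim (simp only: step_fun_grid[OF zero_less_Suc] if_P[OF idx] p_def)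
    ultimately show ?thesis by (rule Lim_transform_eventually)
  qed
  have diff: "\<bar>?g n r - ?f r\<bar> \<le> 2 * E r" for n r
    using gE[of n r] fE[of r r] by linarith
  have fin: "(\<integral>\<^sup>+ r. ennreal (K * E r) \<partial>lborel) < \<infinity>" if "K \<ge> 0" for K
  proof -
    have "(\<integral>\<^sup>+ r. ennreal (norm (K * E r)) \<partial>lborel) < \<infinity>"
      using integrable_mult_right[OF int_E, of K] unfolding integrable_iff_bounded by blast
    moreover have "norm (K * E r) = K * E r" for r using E[of r] that by simp
    ultimately show ?thesis by (simp only:)
  qed
  show ?thesis
    unfolding approximating_steps_def
  proof (intro conjI allI)
    show "is_step (grid_steps ?f (Suc n))" for n
      unfolding is_step_def grid_steps_def by (auto intro: grid_point_mono)
    have "(\<lambda>n. \<integral>\<^sup>+ r. norm (0 - (?g n r - ?f r)) \<partial>lborel) \<longlonglongrightarrow> 0"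
    proof (rule nn_integral_dominated_convergence_norm[where w = "\<lambda>r. 2 * E r"])
      show "AE r in lborel. (\<lambda>n. ?g n r - ?f r) \<longlonglongrightarrow> 0"
        using lim by (simp add: LIM_zero)
    qed (use diff fin[of 2] in auto)
    then show "(\<lambda>n. \<integral>\<^sup>+ r. ennreal \<bar>?g n r - ?f r\<bar> \<partial>lborel) \<longlonglongrightarrow> 0"
      unfolding diff_0 real_norm_def abs_minus_cancel .
    have "(\<lambda>n. \<integral>\<^sup>+ r. norm (0 - (?g n r - ?f r)\<^sup>2) \<partial>lborel) \<longlonglongrightarrow> 0"
    proof (rule nn_integral_dominated_convergence_norm[where w = "\<lambda>r. 4 * C * E r"])
      show "AE r in lborel. (\<lambda>n. (?g n r - ?f r)\<^sup>2) \<longlonglongrightarrow> 0"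
      proof (rule AE_I2)
        fix r
        show "(\<lambda>n. (?g n r - ?f r)\<^sup>2) \<longlonglongrightarrow> 0"
          using tendsto_power[OF LIM_zero[OF lim[of r]], of 2] by simp
      qed
      have "(?g n r - ?f r)\<^sup>2 \<le> 4 * C * E r" for n r
      proof -
        have "(?g n r - ?f r)\<^sup>2 \<le> (2 * E r)\<^sup>2"
          using diff[of n r] E(1)[of r] by (subst abs_le_square_iff[symmetric]) simp
        also have "\<dots> \<le> 4 * C * E r"
          using E[of r] by (simp add: power2_eq_square mult_right_mono)
        finally show ?thesis .
      qed
      then show "AE r in lborel. norm ((?g n r - ?f r)\<^sup>2) \<le> 4 * C * E r" for n by simp
    qed (use fin[of "4 * C"] C in auto)
    then show "(\<lambda>n. \<integral>\<^sup>+ r. ennreal ((?g n r - ?f r)\<^sup>2) \<partial>lborel) \<longlonglongrightarrow> 0"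
      unfolding diff_0 real_norm_def abs_minus_cancel abs_power2 .
  qed
qed

context tempered_path
begin

text \<open>
  A monotone function has only countably many discontinuities.
\<close>

lemma path_AE_continuous: "AE s in lborel. isCont x s"
proof -
  have "AE s in lborel. s \<notin> {s. \<not> isCont x s}"
    using mono_ctble_discont[OF mono] by (intro AE_not_in countable_imp_null_set_lborel)
  then show ?thesis by simp
qed

text \<open>
  Integration by parts in discrete form.  Inserting \<open>mvn_kernel_eq_integral\<close> for the kernel at the grid points and
  telescoping the increments of \<open>x\<close> under the integral gives exactly \<open>- \<integral> h(r) x(grid_ceiling m r) dr\<close>; the value
  of \<open>x\<close> at the left end of the grid drops out because the slope has integral zero.  It remains to let the grid become
  finer, at the continuity points of \<open>x\<close>.
\<close>

lemma step_integral_grid_tendsto: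
  "(\<lambda>n. step_integral (\<lambda>s _. x s) (grid_steps (mvn_kernel a d t) (Suc n)) \<omega>) \<longlonglongrightarrow> path_integral t"
proof -
  let ?h = "kernel_slope a d t"
  note int_h = kernel_slope_integrable[OF a_pos d_neg, of t]
  have eq: "step_integral (\<lambda>s _. x s) (grid_steps (mvn_kernel a d t) m) \<omega>
      = - (LINT r|lborel. ?h r * x (grid_ceiling m r))" if m: "m > 0" for m
  proof -
    let ?\<Delta> = "\<lambda>k. x (grid_point m (Suc k)) - x (grid_point m k)"
    have int: "integrable lborel (\<lambda>r. ?h r * indicator {grid_point m k<..} r * ?\<Delta> k)" for k
      using integrable_mult_indicator[OF _ int_h, of "{grid_point m k<..}"]
      by (intro integrable_mult_left) (simp_all add: mult.commute)
    have S: "(\<Sum>k<2 * m * m. ?h r * indicator {grid_point m k<..} r * ?\<Delta> k)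
        = ?h r * x (grid_ceiling m r) - ?h r * x (- real m)" for r
    proof -
      have "(\<Sum>k<2 * m * m. ?h r * indicator {grid_point m k<..} r * ?\<Delta> k)
          = ?h r * (\<Sum>k<2 * m * m. indicator {grid_point m k<..} r * ?\<Delta> k)"
        unfolding sum_distrib_left by (rule sum.cong[OF refl]) (rule mult.assoc)
      then show ?thesis unfolding grid_telescope[OF m] by (simp only: right_diff_distrib)
    qed
    have "step_integral (\<lambda>s _. x s) (grid_steps (mvn_kernel a d t) m) \<omega>
        = - (\<Sum>k<2 * m * m. LINT r|lborel. ?h r * indicator {grid_point m k<..} r * ?\<Delta> k)"
      by (simp add: step_integral_grid mvn_kernel_eq_integral[OF a_pos d_neg] sum_negf)
    also have "(\<Sum>k<2 * m * m. LINT r|lborel. ?h r * indicator {grid_point m k<..} r * ?\<Delta> k)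
        = (LINT r|lborel. (\<Sum>k<2 * m * m. ?h r * indicator {grid_point m k<..} r * ?\<Delta> k))"
      by (rule Bochner_Integration.integral_sum[symmetric]) (rule int)
    also have "\<dots> = (LINT r|lborel. ?h r * x (grid_ceiling m r) - ?h r * x (- real m))"
      unfolding S ..
    also have "(LINT r|lborel. ?h r * x (grid_ceiling m r) - ?h r * x (- real m))
        = (LINT r|lborel. ?h r * x (grid_ceiling m r)) - (LINT r|lborel. ?h r * x (- real m))"
    proof (rule Bochner_Integration.integral_diff)
      have "integrable lborel (\<lambda>r. (\<Sum>k<2 * m * m. ?h r * indicator {grid_point m k<..} r * ?\<Delta> k) + ?h r * x (- real m))"
        using int int_h by (intro Bochner_Integration.integrable_add Bochner_Integration.integrable_sum) auto
      then show "integrable lborel (\<lambda>r. ?h r * x (grid_ceiling m r))"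
        unfolding S by simp
    qed (use int_h in auto)
    also have "(LINT r|lborel. ?h r * x (- real m)) = 0"
      by (simp add: integral_kernel_slope[OF a_pos d_neg])
    finally show ?thesis by simp
  qed
  \<comment> \<open>To the left of zero, rounding up brings \<open>x\<close> closer to zero; to its right, monotonicity bounds \<open>x\<close> by a later value.\<close>
  have "(\<lambda>n. LINT r|lborel. ?h r * x (grid_ceiling (Suc n) r)) \<longlonglongrightarrow> (LINT r|lborel. ?h r * x r)"
  proof (rule integral_dominated_convergence[where w = "\<lambda>r. \<bar>?h r * x r\<bar> + \<bar>?h r\<bar> * \<bar>x (max 0 t + 1)\<bar>"])
    have "(\<lambda>r. x (grid_ceiling (Suc n) r)) \<in> borel_measurable borel" for n
      using monoD[OF mono] grid_ceiling_mono by (intro borel_measurable_mono monoI) blast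
    then show "(\<lambda>r. ?h r * x (grid_ceiling (Suc n) r)) \<in> borel_measurable lborel" for n by simp
    show "AE r in lborel. (\<lambda>n. ?h r * x (grid_ceiling (Suc n) r)) \<longlonglongrightarrow> ?h r * x r"
      using path_AE_continuous
      by eventually_elim (intro tendsto_mult tendsto_const isCont_tendsto_compose[OF _ grid_ceiling_tendsto])
    show "AE r in lborel. norm (?h r * x (grid_ceiling (Suc n) r)) \<le> \<bar>?h r * x r\<bar> + \<bar>?h r\<bar> * \<bar>x (max 0 t + 1)\<bar>" for n
    proof (intro AE_I2)
      fix r
      let ?c = "grid_ceiling (Suc n) r"
      note c = grid_ceiling_bounds[of "Suc n" r, simplified]
      show "norm (?h r * x ?c) \<le> \<bar>?h r * x r\<bar> + \<bar>?h r\<bar> * \<bar>x (max 0 t + 1)\<bar>"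
      proof (cases "r < max 0 t")
        case True
        have "\<bar>x ?c\<bar> \<le> \<bar>x r\<bar> + \<bar>x (max 0 t + 1)\<bar>"
        proof (cases "r \<le> 0")
          case True
          then have "r \<le> ?c" "?c \<le> 0" using c(2,4) by auto
          then show ?thesis using monoD[OF mono, of r ?c] monoD[OF mono, of ?c 0] zero by auto
        next
          case False
          have "0 \<le> ?c" 
            using grid_ceiling_bounds(2)[of "Suc n" 0] grid_ceiling_mono[of 0 r "Suc n"] False by simp
          moreover have "?c \<le> r + 1 / (1 + real n)" using c(3) False by simp
          moreover have "1 / (1 + real n) \<le> 1" by simp
          ultimately show ?thesis
            using monoD[OF mono, of 0 ?c] monoD[OF mono, of ?c "max 0 t + 1"] zero True by linarith
        qed
        from mult_left_mono[OF this, of "\<bar>?h r\<bar>"] show ?thesis by (simp add: abs_mult distrib_left)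
      next
        case False
        then show ?thesis using kernel_slope_future[of t r a d] by (simp only: not_less) simp
      qed
    qed
    show "integrable lborel (\<lambda>r. \<bar>?h r * x r\<bar> + \<bar>?h r\<bar> * \<bar>x (max 0 t + 1)\<bar>)"
      using kernel_slope_path_integrable[of t] int_h by (intro Bochner_Integration.integrable_add integrable_mult_left) auto
  qed auto
  from tendsto_minus[OF this] show ?thesis
    by (simp add: eq path_integral_def)
qed

end

section \<open>Integrals against a process with given second moments\<close>

lemma step_integral_Nil [simp]: "step_integral X [] \<omega> = 0"
  and step_integral_Cons [simp]:
    "step_integral X ((c, u, v) # \<phi>) \<omega> = c * (X v \<omega> - X u \<omega>) + step_integral X \<phi> \<omega>"
  and step_fun_Nil [simp]: "step_fun [] s = 0"
  and step_fun_Cons [simp]: "step_fun ((c, u, v) # \<phi>) s = c * indicator {u<..v} s + step_fun \<phi> s"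
  and is_step_Nil [simp]: "is_step []"
  and is_step_Cons [simp]: "is_step ((c, u, v) # \<phi>) \<longleftrightarrow> u \<le> v \<and> is_step \<phi>"
  by (simp_all add: step_integral_def step_fun_def is_step_def)

definition step_minus :: "step \<Rightarrow> step \<Rightarrow> step" where
  "step_minus \<phi> \<psi> = \<phi> @ map (\<lambda>(c, u, v). (- c, u, v)) \<psi>"

lemma step_integral_append: "step_integral X (\<phi> @ \<psi>) \<omega> = step_integral X \<phi> \<omega> + step_integral X \<psi> \<omega>"
  by (simp add: step_integral_def)

lemma step_fun_append: "step_fun (\<phi> @ \<psi>) s = step_fun \<phi> s + step_fun \<psi> s"
  by (simp add: step_fun_def)

lemma step_integral_minus: "step_integral X (step_minus \<phi> \<psi>) \<omega> = step_integral X \<phi> \<omega> - step_integral X \<psi> \<omega>"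
proof -
  have "step_integral X (map (\<lambda>(c, u, v). (- c, u, v)) \<psi>) \<omega> = - step_integral X \<psi> \<omega>"
    by (induction \<psi>) auto
  then show ?thesis by (simp add: step_minus_def step_integral_append)
qed

lemma step_fun_minus: "step_fun (step_minus \<phi> \<psi>) s = step_fun \<phi> s - step_fun \<psi> s"
proof -
  have "step_fun (map (\<lambda>(c, u, v). (- c, u, v)) \<psi>) s = - step_fun \<psi> s"
    by (induction \<psi>) auto
  then show ?thesis by (simp add: step_minus_def step_fun_append)
qed

lemma is_step_minus: "\<lbrakk>is_step \<phi>; is_step \<psi>\<rbrakk> \<Longrightarrow> is_step (step_minus \<phi> \<psi>)"
  by (auto simp: is_step_def step_minus_def)

lemma integrable_indicator_Ioc: "integrable lborel (indicator {u<..w} :: real \<Rightarrow> real)"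
  using emeasure_lborel_Icc_eq[of u w] emeasure_mono[of "{u<..w}" "{u..w}" lborel]
  by (intro integrable_real_indicator) (auto intro: order_le_less_trans split: if_splits)

lemma integrable_step_fun: "integrable lborel (step_fun \<phi>)"
proof (induction \<phi>)
  case (Cons p \<phi>)
  obtain c u v where p: "p = (c, u, v)" by (cases p)
  have "integrable lborel (\<lambda>s. c * indicator {u<..v} s + step_fun \<phi> s)"
    using Cons.IH by (intro Bochner_Integration.integrable_add integrable_mult_right)
      (rule integrable_indicator_Ioc)
  then show ?case by (simp add: p)
qed simp

lemma integrable_step_fun_mult: "integrable lborel (\<lambda>s. step_fun \<phi> s * step_fun \<psi> s)"
proof (induction \<phi>)
  case (Cons p \<phi>)
  obtain c u v where p: "p = (c, u, v)" by (cases p)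
  have "integrable lborel (\<lambda>s. c * (indicator {u<..v} s *\<^sub>R step_fun \<psi> s) + step_fun \<phi> s * step_fun \<psi> s)"
    using Cons.IH integrable_step_fun
    by (intro Bochner_Integration.integrable_add integrable_mult_right integrable_mult_indicator) auto
  then show ?case by (simp add: p algebra_simps)
qed simp

lemma AE_step_integral_cong:
  assumes "\<And>t. AE \<omega> in M. X t \<omega> = X' t \<omega>"
  shows "AE \<omega> in M. step_integral X \<phi> \<omega> = step_integral X' \<phi> \<omega>"
proof (induction \<phi>)
  case (Cons p \<phi>)
  obtain c u v where p: "p = (c, u, v)" by (cases p)
  from Cons.IH assms[of u] assms[of v] show ?case
    by eventually_elim (simp add: p)
qed simp

text \<open>
  A step integral involves finitely many times, so it cannot tell a process from a modification of it.
\<close>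

lemma has_L2_integral_cong_process:
  assumes eq: "\<And>t. AE \<omega> in M. X t \<omega> = X' t \<omega>"
  shows "has_L2_integral M X f Z \<longleftrightarrow> has_L2_integral M X' f Z"
proof -
  have "(\<integral>\<^sup>+ \<omega>. ennreal ((step_integral X \<phi> \<omega> - Z \<omega>)\<^sup>2) \<partial>M)
      = (\<integral>\<^sup>+ \<omega>. ennreal ((step_integral X' \<phi> \<omega> - Z \<omega>)\<^sup>2) \<partial>M)" for \<phi>
  proof (rule nn_integral_cong_AE)
    have "AE \<omega> in M. step_integral X \<phi> \<omega> = step_integral X' \<phi> \<omega>"
      using eq by (rule AE_step_integral_cong)
    then show "AE \<omega> in M. ennreal ((step_integral X \<phi> \<omega> - Z \<omega>)\<^sup>2) = ennreal ((step_integral X' \<phi> \<omega> - Z \<omega>)\<^sup>2)"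
      by eventually_elim simp
  qed
  then show ?thesis unfolding has_L2_integral_def by simp
qed

lemma square_diff_le:
  fixes x y z :: real
  shows "(x - y)\<^sup>2 \<le> 2 * (x - z)\<^sup>2 + 2 * (y - z)\<^sup>2"
proof -
  have "2 * (x - z)\<^sup>2 + 2 * (y - z)\<^sup>2 - (x - y)\<^sup>2 = (x + y - 2 * z)\<^sup>2"
    by (simp add: power2_eq_square algebra_simps)
  then show ?thesis by (smt (verit) zero_le_power2)
qed

lemma nn_integral_square_diff_le:
  fixes f g h :: "'c \<Rightarrow> real"
  assumes [measurable]: "f \<in> borel_measurable M" "g \<in> borel_measurable M" "h \<in> borel_measurable M"
  shows "(\<integral>\<^sup>+ x. ennreal ((f x - g x)\<^sup>2) \<partial>M) \<le>
    2 * (\<integral>\<^sup>+ x. ennreal ((f x - h x)\<^sup>2) \<partial>M) + 2 * (\<integral>\<^sup>+ x. ennreal ((g x - h x)\<^sup>2) \<partial>M)"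
proof -
  have "ennreal ((f x - g x)\<^sup>2) \<le> 2 * ennreal ((f x - h x)\<^sup>2) + 2 * ennreal ((g x - h x)\<^sup>2)" for x
  proof -
    have "ennreal ((f x - g x)\<^sup>2) \<le> ennreal (2 * (f x - h x)\<^sup>2 + 2 * (g x - h x)\<^sup>2)"
      by (intro ennreal_leI square_diff_le)
    then show ?thesis by (simp add: ennreal_plus ennreal_mult)
  qed
  then have "(\<integral>\<^sup>+ x. ennreal ((f x - g x)\<^sup>2) \<partial>M) \<le>
      (\<integral>\<^sup>+ x. 2 * ennreal ((f x - h x)\<^sup>2) + 2 * ennreal ((g x - h x)\<^sup>2) \<partial>M)"
    by (intro nn_integral_mono)
  also have "\<dots> = 2 * (\<integral>\<^sup>+ x. ennreal ((f x - h x)\<^sup>2) \<partial>M) + 2 * (\<integral>\<^sup>+ x. ennreal ((g x - h x)\<^sup>2) \<partial>M)"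
    by (simp add: nn_integral_add nn_integral_cmult)
  finally show ?thesis .
qed

text \<open>
  Second moments of a process with stationary independent increments on both sides of zero, mean \<open>m\<close> and variance
  \<open>v\<close> at time one.  The expression \<open>(\<bar>s\<bar> + \<bar>t\<bar> - \<bar>s - t\<bar>) / 2\<close> is the length of the common part of the intervals from
  \<open>0\<close> to \<open>s\<close> and from \<open>0\<close> to \<open>t\<close>; it covers all combinations of signs at once.
\<close>

locale second_order_process = prob_space M for M :: "'a measure" +
  fixes X :: "real \<Rightarrow> 'a \<Rightarrow> real" and m v :: real
  assumes measurable_process [measurable]: "\<And>t. X t \<in> borel_measurable M"
    and variance_nonneg: "0 \<le> v"
    and product_moment: "\<And>s t. has_bochner_integral M (\<lambda>\<omega>. X s \<omega> * X t \<omega>)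
      (v * ((\<bar>s\<bar> + \<bar>t\<bar> - \<bar>s - t\<bar>) / 2) + m\<^sup>2 * (s * t))"
begin

lemma measurable_step_integral [measurable]: "step_integral X \<phi> \<in> borel_measurable M"
proof (induction \<phi>)
  case (Cons p \<phi>)
  obtain c u v where p: "p = (c, u, v)" by (cases p)
  have "step_integral X (p # \<phi>) = (\<lambda>\<omega>. c * (X v \<omega> - X u \<omega>) + step_integral X \<phi> \<omega>)"
    by (simp add: p fun_eq_iff)
  then show ?case using Cons.IH by simp
qed (simp add: step_integral_def[abs_def])

text \<open>
  The covariance of two increments is \<open>v\<close> times the length of the overlap of the intervals.
\<close>

lemma increment_product_moment:
  assumes "u \<le> w" "u' \<le> w'"
  shows "has_bochner_integral M (\<lambda>\<omega>. (X w \<omega> - X u \<omega>) * (X w' \<omega> - X u' \<omega>))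
    (v * (LINT s|lborel. indicator {u<..w} s * indicator {u'<..w'} s) + m\<^sup>2 * ((w - u) * (w' - u')))"
proof -
  let ?k = "\<lambda>s t::real. (\<bar>s\<bar> + \<bar>t\<bar> - \<bar>s - t\<bar>) / 2"
  have bilinear: "((v * A + q * (w * w')) - (v * B + q * (u * w'))) - ((v * C + q * (w * u')) - (v * D + q * (u * u')))
      = v * (A - B - (C - D)) + q * ((w - u) * (w' - u'))" for A B C D q :: real
    by algebra
  have "has_bochner_integral M (\<lambda>\<omega>. (X w \<omega> * X w' \<omega> - X u \<omega> * X w' \<omega>) - (X w \<omega> * X u' \<omega> - X u \<omega> * X u' \<omega>))
    (((v * ?k w w' + m\<^sup>2 * (w * w')) - (v * ?k u w' + m\<^sup>2 * (u * w'))) -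
     ((v * ?k w u' + m\<^sup>2 * (w * u')) - (v * ?k u u' + m\<^sup>2 * (u * u'))))"
    by (intro has_bochner_integral_diff product_moment)
  moreover have "(LINT s|lborel. indicator {u<..w} s * indicator {u'<..w'} s) = ?k w w' - ?k u w' - (?k w u' - ?k u u')"
  proof -
    have "(LINT s|lborel. indicator {u<..w} s * indicator {u'<..w'} s) = (LINT s|lborel. indicat_real {max u u'<..min w w'} s)"
      by (intro Bochner_Integration.integral_cong) (auto split: split_indicator)
    also have "\<dots> = max 0 (min w w' - max u u')"
      by (cases "max u u' \<le> min w w'") auto
    also have "\<dots> = ?k w w' - ?k u w' - (?k w u' - ?k u u')"
      using assms by (simp add: max_def min_def abs_if)
    finally show ?thesis .
  qed
  then have "((v * ?k w w' + m\<^sup>2 * (w * w')) - (v * ?k u w' + m\<^sup>2 * (u * w'))) -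
     ((v * ?k w u' + m\<^sup>2 * (w * u')) - (v * ?k u u' + m\<^sup>2 * (u * u')))
     = v * (LINT s|lborel. indicator {u<..w} s * indicator {u'<..w'} s) + m\<^sup>2 * ((w - u) * (w' - u'))"
    by (simp only: bilinear)
  moreover have "(\<lambda>\<omega>. (X w \<omega> * X w' \<omega> - X u \<omega> * X w' \<omega>) - (X w \<omega> * X u' \<omega> - X u \<omega> * X u' \<omega>))
      = (\<lambda>\<omega>. (X w \<omega> - X u \<omega>) * (X w' \<omega> - X u' \<omega>))"
    by (intro ext) algebra
  ultimately show ?thesis by (simp only:)
qed

lemma increment_step_integral_moment:
  assumes "u \<le> w" "is_step \<psi>"
  shows "has_bochner_integral M (\<lambda>\<omega>. (X w \<omega> - X u \<omega>) * step_integral X \<psi> \<omega>)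
    (v * (LINT s|lborel. indicator {u<..w} s * step_fun \<psi> s) + m\<^sup>2 * ((w - u) * integral\<^sup>L lborel (step_fun \<psi>)))"
  using assms(2)
proof (induction \<psi>)
  case Nil
  show ?case by (simp add: has_bochner_integral_zero)
next
  case (Cons p \<psi>)
  obtain c u' w' where p: "p = (c, u', w')" by (cases p)
  have uw: "u' \<le> w'" and \<psi>: "is_step \<psi>" using Cons.prems by (simp_all add: p)
  let ?i = "indicator {u<..w} :: real \<Rightarrow> real" and ?j = "indicator {u'<..w'} :: real \<Rightarrow> real"
  have j: "integrable lborel ?j" by (rule integrable_indicator_Ioc)
  have ij: "integrable lborel (\<lambda>s. ?i s * ?j s)" "integrable lborel (\<lambda>s. ?i s * step_fun \<psi> s)"
    using integrable_mult_indicator[OF _ j, of "{u<..w}"] integrable_mult_indicator[OF _ integrable_step_fun[of \<psi>], of "{u<..w}"]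
    by simp_all
  have 1: "(LINT s|lborel. ?i s * step_fun (p # \<psi>) s) = c * (LINT s|lborel. ?i s * ?j s) + (LINT s|lborel. ?i s * step_fun \<psi> s)"
  proof -
    have "(LINT s|lborel. ?i s * step_fun (p # \<psi>) s) = (LINT s|lborel. c * (?i s * ?j s) + ?i s * step_fun \<psi> s)"
      by (intro Bochner_Integration.integral_cong refl) (simp add: p algebra_simps)
    then show ?thesis using ij by simp
  qed
  have 2: "integral\<^sup>L lborel (step_fun (p # \<psi>)) = c * (w' - u') + integral\<^sup>L lborel (step_fun \<psi>)"
  proof -
    have "integral\<^sup>L lborel (step_fun (p # \<psi>)) = (LINT s|lborel. c * ?j s + step_fun \<psi> s)"
      by (intro Bochner_Integration.integral_cong refl) (simp add: p)
    then show ?thesis using j integrable_step_fun[of \<psi>] uw by simp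
  qed
  have "has_bochner_integral M (\<lambda>\<omega>. c * ((X w \<omega> - X u \<omega>) * (X w' \<omega> - X u' \<omega>)) + (X w \<omega> - X u \<omega>) * step_integral X \<psi> \<omega>)
    (c * (v * (LINT s|lborel. ?i s * ?j s) + m\<^sup>2 * ((w - u) * (w' - u')))
      + (v * (LINT s|lborel. ?i s * step_fun \<psi> s) + m\<^sup>2 * ((w - u) * integral\<^sup>L lborel (step_fun \<psi>))))"
    using assms(1) uw Cons.IH[OF \<psi>]
    by (intro has_bochner_integral_add has_bochner_integral_mult_right increment_product_moment)
  moreover have "(\<lambda>\<omega>. c * ((X w \<omega> - X u \<omega>) * (X w' \<omega> - X u' \<omega>)) + (X w \<omega> - X u \<omega>) * step_integral X \<psi> \<omega>)
      = (\<lambda>\<omega>. (X w \<omega> - X u \<omega>) * step_integral X (p # \<psi>) \<omega>)"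
    by (intro ext) (simp add: p algebra_simps)
  moreover have "c * (v * (LINT s|lborel. ?i s * ?j s) + m\<^sup>2 * ((w - u) * (w' - u')))
      + (v * (LINT s|lborel. ?i s * step_fun \<psi> s) + m\<^sup>2 * ((w - u) * integral\<^sup>L lborel (step_fun \<psi>)))
      = v * (LINT s|lborel. ?i s * step_fun (p # \<psi>) s) + m\<^sup>2 * ((w - u) * integral\<^sup>L lborel (step_fun (p # \<psi>)))"
    unfolding 1 2 by algebra
  ultimately show ?case by (simp only:)
qed

text \<open>
  Both sides are bilinear in the step functions, so the identity extends from single intervals, which may overlap.
\<close>

lemma step_integral_product_moment:
  assumes "is_step \<phi>" "is_step \<psi>"
  shows "has_bochner_integral M (\<lambda>\<omega>. step_integral X \<phi> \<omega> * step_integral X \<psi> \<omega>)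
    (v * (LINT s|lborel. step_fun \<phi> s * step_fun \<psi> s)
      + m\<^sup>2 * (integral\<^sup>L lborel (step_fun \<phi>) * integral\<^sup>L lborel (step_fun \<psi>)))"
  using assms(1)
proof (induction \<phi>)
  case Nil
  show ?case by (simp add: has_bochner_integral_zero)
next
  case (Cons p \<phi>)
  obtain c u w where p: "p = (c, u, w)" by (cases p)
  have uw: "u \<le> w" and \<phi>: "is_step \<phi>" using Cons.prems by (simp_all add: p)
  let ?i = "indicator {u<..w} :: real \<Rightarrow> real"
  have i: "integrable lborel ?i" by (rule integrable_indicator_Ioc)
  have i\<psi>: "integrable lborel (\<lambda>s. ?i s * step_fun \<psi> s)"
    using integrable_mult_indicator[OF _ integrable_step_fun[of \<psi>], of "{u<..w}"] by simp
  have 1: "(LINT s|lborel. step_fun (p # \<phi>) s * step_fun \<psi> s)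
      = c * (LINT s|lborel. ?i s * step_fun \<psi> s) + (LINT s|lborel. step_fun \<phi> s * step_fun \<psi> s)"
  proof -
    have "(LINT s|lborel. step_fun (p # \<phi>) s * step_fun \<psi> s)
        = (LINT s|lborel. c * (?i s * step_fun \<psi> s) + step_fun \<phi> s * step_fun \<psi> s)"
      by (intro Bochner_Integration.integral_cong refl) (simp add: p algebra_simps)
    then show ?thesis using i\<psi> integrable_step_fun_mult[of \<phi> \<psi>] by simp
  qed
  have 2: "integral\<^sup>L lborel (step_fun (p # \<phi>)) = c * (w - u) + integral\<^sup>L lborel (step_fun \<phi>)"
  proof -
    have "integral\<^sup>L lborel (step_fun (p # \<phi>)) = (LINT s|lborel. c * ?i s + step_fun \<phi> s)"
      by (intro Bochner_Integration.integral_cong refl) (simp add: p)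
    then show ?thesis using i integrable_step_fun[of \<phi>] uw by simp
  qed
  have "has_bochner_integral M (\<lambda>\<omega>. c * ((X w \<omega> - X u \<omega>) * step_integral X \<psi> \<omega>) + step_integral X \<phi> \<omega> * step_integral X \<psi> \<omega>)
    (c * (v * (LINT s|lborel. ?i s * step_fun \<psi> s) + m\<^sup>2 * ((w - u) * integral\<^sup>L lborel (step_fun \<psi>)))
      + (v * (LINT s|lborel. step_fun \<phi> s * step_fun \<psi> s)
      + m\<^sup>2 * (integral\<^sup>L lborel (step_fun \<phi>) * integral\<^sup>L lborel (step_fun \<psi>))))"
    using uw assms(2) Cons.IH[OF \<phi>]
    by (intro has_bochner_integral_add has_bochner_integral_mult_right increment_step_integral_moment)
  moreover have "(\<lambda>\<omega>. c * ((X w \<omega> - X u \<omega>) * step_integral X \<psi> \<omega>) + step_integral X \<phi> \<omega> * step_integral X \<psi> \<omega>)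
      = (\<lambda>\<omega>. step_integral X (p # \<phi>) \<omega> * step_integral X \<psi> \<omega>)"
    by (intro ext) (simp add: p algebra_simps)
  moreover have "c * (v * (LINT s|lborel. ?i s * step_fun \<psi> s) + m\<^sup>2 * ((w - u) * integral\<^sup>L lborel (step_fun \<psi>)))
      + (v * (LINT s|lborel. step_fun \<phi> s * step_fun \<psi> s)
      + m\<^sup>2 * (integral\<^sup>L lborel (step_fun \<phi>) * integral\<^sup>L lborel (step_fun \<psi>)))
      = v * (LINT s|lborel. step_fun (p # \<phi>) s * step_fun \<psi> s)
      + m\<^sup>2 * (integral\<^sup>L lborel (step_fun (p # \<phi>)) * integral\<^sup>L lborel (step_fun \<psi>))"
    unfolding 1 2 by algebra
  ultimately show ?case by (simp only:)
qed

lemma step_integral_square_integrable: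
  "is_step \<phi> \<Longrightarrow> integrable M (\<lambda>\<omega>. (step_integral X \<phi> \<omega>)\<^sup>2)"
  using step_integral_product_moment[of \<phi> \<phi>] by (auto simp: power2_eq_square has_bochner_integral_iff)

text \<open>
  The difference of two step integrals is the integral of the difference of the step functions; comparison with a common
  target \<open>f\<close> then turns the identity for its second moment into a bound in which \<open>\<phi>\<close> and \<open>\<psi>\<close> are separated.
\<close>

lemma step_integral_diff_le:
  assumes \<phi>: "is_step \<phi>" and \<psi>: "is_step \<psi>" and [measurable]: "f \<in> borel_measurable borel"
  shows "(\<integral>\<^sup>+ \<omega>. ennreal ((step_integral X \<phi> \<omega> - step_integral X \<psi> \<omega>)\<^sup>2) \<partial>M) \<le>
    ennreal v * (2 * (\<integral>\<^sup>+ s. ennreal ((step_fun \<phi> s - f s)\<^sup>2) \<partial>lborel)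
      + 2 * (\<integral>\<^sup>+ s. ennreal ((step_fun \<psi> s - f s)\<^sup>2) \<partial>lborel))
    + ennreal (m\<^sup>2) * (((\<integral>\<^sup>+ s. ennreal \<bar>step_fun \<phi> s - f s\<bar> \<partial>lborel) + (\<integral>\<^sup>+ s. ennreal \<bar>step_fun \<psi> s - f s\<bar> \<partial>lborel))
      * ((\<integral>\<^sup>+ s. ennreal \<bar>step_fun \<phi> s - f s\<bar> \<partial>lborel) + (\<integral>\<^sup>+ s. ennreal \<bar>step_fun \<psi> s - f s\<bar> \<partial>lborel)))"
proof -
  let ?\<chi> = "step_minus \<phi> \<psi>"
  let ?L1 = "(\<integral>\<^sup>+ s. ennreal \<bar>step_fun \<phi> s - f s\<bar> \<partial>lborel) + (\<integral>\<^sup>+ s. ennreal \<bar>step_fun \<psi> s - f s\<bar> \<partial>lborel)"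
  define A where "A = (LINT s|lborel. step_fun ?\<chi> s * step_fun ?\<chi> s)"
  define B where "B = \<bar>integral\<^sup>L lborel (step_fun ?\<chi>)\<bar>"
  have "has_bochner_integral M (\<lambda>\<omega>. step_integral X ?\<chi> \<omega> * step_integral X ?\<chi> \<omega>) (v * A + m\<^sup>2 * (B * B))"
    using step_integral_product_moment[OF is_step_minus[OF \<phi> \<psi>] is_step_minus[OF \<phi> \<psi>]] by (simp add: A_def B_def)
  then have "(\<integral>\<^sup>+ \<omega>. ennreal (step_integral X ?\<chi> \<omega> * step_integral X ?\<chi> \<omega>) \<partial>M) = ennreal (v * A + m\<^sup>2 * (B * B))"
    by (intro nn_integral_eq_integral[THEN trans]) (auto simp: has_bochner_integral_iff)
  then have eq: "(\<integral>\<^sup>+ \<omega>. ennreal ((step_integral X \<phi> \<omega> - step_integral X \<psi> \<omega>)\<^sup>2) \<partial>M) = ennreal (v * A + m\<^sup>2 * (B * B))"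
    by (simp add: step_integral_minus power2_eq_square)
  have A0: "0 \<le> A" and B0: "0 \<le> B" by (auto simp: A_def B_def)
  have "ennreal A = (\<integral>\<^sup>+ s. ennreal ((step_fun \<phi> s - step_fun \<psi> s)\<^sup>2) \<partial>lborel)"
    unfolding A_def using integrable_step_fun_mult[of ?\<chi> ?\<chi>]
    by (subst nn_integral_eq_integral[symmetric]) (auto simp: step_fun_minus power2_eq_square)
  also have "\<dots> \<le> 2 * (\<integral>\<^sup>+ s. ennreal ((step_fun \<phi> s - f s)\<^sup>2) \<partial>lborel)
      + 2 * (\<integral>\<^sup>+ s. ennreal ((step_fun \<psi> s - f s)\<^sup>2) \<partial>lborel)"
    by (rule nn_integral_square_diff_le) auto
  finally have A: "ennreal A \<le> \<dots>" .
  have "ennreal B \<le> ennreal (LINT s|lborel. \<bar>step_fun ?\<chi> s\<bar>)"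
    unfolding B_def using integral_norm_bound[of lborel "step_fun ?\<chi>"] by (intro ennreal_leI) simp
  also have "\<dots> = (\<integral>\<^sup>+ s. ennreal \<bar>step_fun \<phi> s - step_fun \<psi> s\<bar> \<partial>lborel)"
    using integrable_abs[OF integrable_step_fun[of ?\<chi>]]
    by (subst nn_integral_eq_integral[symmetric]) (auto simp: step_fun_minus)
  also have "\<dots> \<le> (\<integral>\<^sup>+ s. ennreal \<bar>step_fun \<phi> s - f s\<bar> + ennreal \<bar>step_fun \<psi> s - f s\<bar> \<partial>lborel)"
    by (intro nn_integral_mono) (auto simp flip: ennreal_plus intro!: ennreal_leI)
  also have "\<dots> = ?L1" by (intro nn_integral_add) auto
  finally have B: "ennreal B \<le> ?L1" .
  have "ennreal (v * A + m\<^sup>2 * (B * B)) = ennreal v * ennreal A + ennreal (m\<^sup>2) * (ennreal B * ennreal B)"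
    using A0 B0 variance_nonneg by (simp add: ennreal_plus ennreal_mult)
  also have "\<dots> \<le> ennreal v * (2 * (\<integral>\<^sup>+ s. ennreal ((step_fun \<phi> s - f s)\<^sup>2) \<partial>lborel)
      + 2 * (\<integral>\<^sup>+ s. ennreal ((step_fun \<psi> s - f s)\<^sup>2) \<partial>lborel)) + ennreal (m\<^sup>2) * (?L1 * ?L1)"
    using A B by (intro add_mono mult_mono) auto
  finally show ?thesis unfolding eq .
qed

text \<open>
  Fatou's lemma in \<open>n\<close>, applied to \<open>step_integral_diff_le\<close> for \<open>\<phi>\<close> and \<open>\<psi> n\<close>: the errors of \<open>\<psi> n\<close> disappear in the
  limit and only those of \<open>\<phi>\<close> remain.
\<close>

lemma step_integral_limit_le:
  assumes \<phi>: "is_step \<phi>" and \<psi>: "approximating_steps \<psi> f" and [measurable]: "f \<in> borel_measurable borel"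
    and lim: "\<And>\<omega>. \<omega> \<in> space M \<Longrightarrow> (\<lambda>n. step_integral X (\<psi> n) \<omega>) \<longlonglongrightarrow> Z \<omega>"
  shows "(\<integral>\<^sup>+ \<omega>. ennreal ((step_integral X \<phi> \<omega> - Z \<omega>)\<^sup>2) \<partial>M) \<le>
    ennreal v * (2 * (\<integral>\<^sup>+ s. ennreal ((step_fun \<phi> s - f s)\<^sup>2) \<partial>lborel))
    + ennreal (m\<^sup>2) * ((\<integral>\<^sup>+ s. ennreal \<bar>step_fun \<phi> s - f s\<bar> \<partial>lborel) * (\<integral>\<^sup>+ s. ennreal \<bar>step_fun \<phi> s - f s\<bar> \<partial>lborel))"
    (is "_ \<le> ?R")
proof -
  let ?e1 = "\<lambda>\<phi>. \<integral>\<^sup>+ s. ennreal \<bar>step_fun \<phi> s - f s\<bar> \<partial>lborel"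
  let ?e2 = "\<lambda>\<phi>. \<integral>\<^sup>+ s. ennreal ((step_fun \<phi> s - f s)\<^sup>2) \<partial>lborel"
  have step: "\<And>n. is_step (\<psi> n)" and e1: "(\<lambda>n. ?e1 (\<psi> n)) \<longlonglongrightarrow> 0" and e2: "(\<lambda>n. ?e2 (\<psi> n)) \<longlonglongrightarrow> 0"
    using \<psi> by (auto simp: approximating_steps_def)
  have "(\<integral>\<^sup>+ \<omega>. ennreal ((step_integral X \<phi> \<omega> - Z \<omega>)\<^sup>2) \<partial>M)
      = (\<integral>\<^sup>+ \<omega>. liminf (\<lambda>n. ennreal ((step_integral X \<phi> \<omega> - step_integral X (\<psi> n) \<omega>)\<^sup>2)) \<partial>M)"
  proof (rule nn_integral_cong)
    fix \<omega> assume "\<omega> \<in> space M"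
    then have "(\<lambda>n. ennreal ((step_integral X \<phi> \<omega> - step_integral X (\<psi> n) \<omega>)\<^sup>2)) \<longlonglongrightarrow> ennreal ((step_integral X \<phi> \<omega> - Z \<omega>)\<^sup>2)"
      using lim by (intro tendsto_ennrealI tendsto_intros) auto
    from lim_imp_Liminf[OF _ this]
    show "ennreal ((step_integral X \<phi> \<omega> - Z \<omega>)\<^sup>2) = liminf (\<lambda>n. ennreal ((step_integral X \<phi> \<omega> - step_integral X (\<psi> n) \<omega>)\<^sup>2))"
      by simp
  qed
  also have "\<dots> \<le> liminf (\<lambda>n. \<integral>\<^sup>+ \<omega>. ennreal ((step_integral X \<phi> \<omega> - step_integral X (\<psi> n) \<omega>)\<^sup>2) \<partial>M)"
    by (intro nn_integral_liminf) auto
  also have "\<dots> \<le> liminf (\<lambda>n. ennreal v * (2 * ?e2 \<phi> + 2 * ?e2 (\<psi> n))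
      + ennreal (m\<^sup>2) * ((?e1 \<phi> + ?e1 (\<psi> n)) * (?e1 \<phi> + ?e1 (\<psi> n))))"
    using \<phi> step by (intro Liminf_mono always_eventually allI step_integral_diff_le) auto
  also have "\<dots> = ?R"
  proof -
    have "(\<lambda>n. ennreal v * (2 * ?e2 \<phi> + 2 * ?e2 (\<psi> n)) + ennreal (m\<^sup>2) * ((?e1 \<phi> + ?e1 (\<psi> n)) * (?e1 \<phi> + ?e1 (\<psi> n))))
        \<longlonglongrightarrow> ennreal v * (2 * ?e2 \<phi> + 2 * 0) + ennreal (m\<^sup>2) * ((?e1 \<phi> + 0) * (?e1 \<phi> + 0))"
      by (intro tendsto_add ennreal_tendsto_cmult tendsto_mult_ennreal tendsto_const e1 e2) auto
    from lim_imp_Liminf[OF _ this] show ?thesis by simp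
  qed
  finally show ?thesis .
qed

text \<open>
  One approximating sequence that converges at every outcome identifies the integral: by \<open>step_integral_limit_le\<close> all
  other approximating sequences converge to the same limit in L2.
\<close>

theorem has_L2_integral_pathwise_limit:
  assumes \<psi>: "approximating_steps \<psi> f" and f [measurable]: "f \<in> borel_measurable borel"
    and lim: "\<And>\<omega>. \<omega> \<in> space M \<Longrightarrow> (\<lambda>n. step_integral X (\<psi> n) \<omega>) \<longlonglongrightarrow> Z \<omega>"
  shows "has_L2_integral M X f Z"
  unfolding has_L2_integral_def
proof (intro conjI allI impI)
  let ?e1 = "\<lambda>\<phi>. \<integral>\<^sup>+ s. ennreal \<bar>step_fun \<phi> s - f s\<bar> \<partial>lborel"
  let ?e2 = "\<lambda>\<phi>. \<integral>\<^sup>+ s. ennreal ((step_fun \<phi> s - f s)\<^sup>2) \<partial>lborel"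
  let ?err = "\<lambda>\<phi>. \<integral>\<^sup>+ \<omega>. ennreal ((step_integral X \<phi> \<omega> - Z \<omega>)\<^sup>2) \<partial>M"
  show f: "f \<in> borel_measurable borel" by fact
  show Z [measurable]: "Z \<in> borel_measurable M"
    using lim by (rule borel_measurable_LIMSEQ_real) measurable
  show "\<exists>\<phi>. approximating_steps \<phi> f" using \<psi> by blast
  show conv: "(\<lambda>n. ?err (\<phi> n)) \<longlonglongrightarrow> 0" if \<phi>: "approximating_steps \<phi> f" for \<phi>
  proof (rule tendsto_sandwich[where f = "\<lambda>_. 0"])
    show "eventually (\<lambda>n. ?err (\<phi> n) \<le> ennreal v * (2 * ?e2 (\<phi> n)) + ennreal (m\<^sup>2) * (?e1 (\<phi> n) * ?e1 (\<phi> n))) sequentially"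
      using \<phi> by (intro always_eventually allI step_integral_limit_le[OF _ \<psi> f lim]) (auto simp: approximating_steps_def)
    have "(\<lambda>n. ennreal v * (2 * ?e2 (\<phi> n)) + ennreal (m\<^sup>2) * (?e1 (\<phi> n) * ?e1 (\<phi> n)))
        \<longlonglongrightarrow> ennreal v * (2 * 0) + ennreal (m\<^sup>2) * (0 * 0)"
      using \<phi> unfolding approximating_steps_def
      by (intro tendsto_add ennreal_tendsto_cmult tendsto_mult_ennreal) auto
    then show "(\<lambda>n. ennreal v * (2 * ?e2 (\<phi> n)) + ennreal (m\<^sup>2) * (?e1 (\<phi> n) * ?e1 (\<phi> n))) \<longlonglongrightarrow> 0" by simp
  qed simp_all
  have "eventually (\<lambda>n. ?err (\<psi> n) < 1) sequentially"
    using conv[OF \<psi>] by (rule order_tendstoD) simp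
  then obtain n where n: "?err (\<psi> n) < 1" by (auto dest: eventually_happens)
  have "(\<integral>\<^sup>+ \<omega>. ennreal ((Z \<omega> - 0)\<^sup>2) \<partial>M) \<le>
      2 * (\<integral>\<^sup>+ \<omega>. ennreal ((Z \<omega> - step_integral X (\<psi> n) \<omega>)\<^sup>2) \<partial>M)
      + 2 * (\<integral>\<^sup>+ \<omega>. ennreal ((0 - step_integral X (\<psi> n) \<omega>)\<^sup>2) \<partial>M)"
    by (rule nn_integral_square_diff_le) auto
  also have "\<dots> < \<infinity>"
  proof -
    have "(\<integral>\<^sup>+ \<omega>. ennreal ((0 - step_integral X (\<psi> n) \<omega>)\<^sup>2) \<partial>M) < \<infinity>"
      using step_integral_square_integrable[of "\<psi> n"] \<psi>
      by (auto simp: approximating_steps_def integrable_iff_bounded)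
    moreover have "(\<integral>\<^sup>+ \<omega>. ennreal ((Z \<omega> - step_integral X (\<psi> n) \<omega>)\<^sup>2) \<partial>M) < \<infinity>"
      using n by (subst power2_commute) (auto intro: less_trans)
    ultimately show ?thesis by (simp add: ennreal_mult_less_top)
  qed
  finally show "integrable M (\<lambda>\<omega>. (Z \<omega>)\<^sup>2)"
    by (simp add: integrable_iff_bounded)
qed

lemma has_L2_integral_unique:
  assumes Z: "has_L2_integral M X f Z" and Z': "has_L2_integral M X f Z'"
  shows "AE \<omega> in M. Z \<omega> = Z' \<omega>"
proof -
  obtain \<phi> where \<phi>: "approximating_steps \<phi> f" using Z by (auto simp: has_L2_integral_def)
  have [measurable]: "Z \<in> borel_measurable M" "Z' \<in> borel_measurable M"
    using Z Z' by (auto simp: has_L2_integral_def)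
  let ?err = "\<lambda>Z n. \<integral>\<^sup>+ \<omega>. ennreal ((step_integral X (\<phi> n) \<omega> - Z \<omega>)\<^sup>2) \<partial>M"
  have "(\<integral>\<^sup>+ \<omega>. ennreal ((Z \<omega> - Z' \<omega>)\<^sup>2) \<partial>M) \<le> 2 * ?err Z n + 2 * ?err Z' n" for n
  proof -
    have "(\<integral>\<^sup>+ \<omega>. ennreal ((Z \<omega> - Z' \<omega>)\<^sup>2) \<partial>M) \<le>
        2 * (\<integral>\<^sup>+ \<omega>. ennreal ((Z \<omega> - step_integral X (\<phi> n) \<omega>)\<^sup>2) \<partial>M)
        + 2 * (\<integral>\<^sup>+ \<omega>. ennreal ((Z' \<omega> - step_integral X (\<phi> n) \<omega>)\<^sup>2) \<partial>M)"
      by (rule nn_integral_square_diff_le) auto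
    then show ?thesis
      by (simp only: power2_commute[of "Z _" "step_integral X (\<phi> n) _"] power2_commute[of "Z' _" "step_integral X (\<phi> n) _"])
  qed
  moreover have "(\<lambda>n. 2 * ?err Z n + 2 * ?err Z' n) \<longlonglongrightarrow> 2 * 0 + 2 * 0"
    using Z Z' \<phi> by (intro tendsto_add ennreal_tendsto_cmult) (auto simp: has_L2_integral_def)
  ultimately have "(\<integral>\<^sup>+ \<omega>. ennreal ((Z \<omega> - Z' \<omega>)\<^sup>2) \<partial>M) \<le> 2 * 0 + 2 * 0"
    by (intro LIMSEQ_le_const) auto
  then have "(\<integral>\<^sup>+ \<omega>. ennreal ((Z \<omega> - Z' \<omega>)\<^sup>2) \<partial>M) = 0" by simp
  then show ?thesis
    by (subst (asm) nn_integral_0_iff_AE) (auto simp: ennreal_eq_0_iff elim!: eventually_mono)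
qed

end

section \<open>Moments of a square integrable subordinator\<close>

text \<open>
  Cauchy's functional equation.  The function is increasing, and comparing \<open>n * t\<close> with the two neighbouring integers
  bounds \<open>n * \<bar>f t - t * f 1\<bar>\<close> by \<open>f 1\<close> for every \<open>n\<close>.
\<close>

lemma additive_nonneg_imp_linear:
  fixes f :: "real \<Rightarrow> real"
  assumes add: "\<And>s t. \<lbrakk>0 \<le> s; 0 \<le> t\<rbrakk> \<Longrightarrow> f (s + t) = f s + f t"
    and nonneg: "\<And>t. 0 \<le> t \<Longrightarrow> 0 \<le> f t" and t: "0 \<le> t"
  shows "f t = t * f 1"
proof -
  have mono: "f r \<le> f s" if "0 \<le> r" "r \<le> s" for r s
    using add[of r "s - r"] nonneg[of "s - r"] that by simp
  have zero: "f 0 = 0" using add[of 0 0] by simp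
  have mult: "f (real n * s) = real n * f s" if "0 \<le> s" for n s
  proof (induction n)
    case (Suc n)
    have "f (real n * s + s) = f (real n * s) + f s" using that by (intro add) auto
    with Suc.IH show ?case by (simp add: algebra_simps)
  qed (simp add: zero)
  have close: "real n * \<bar>f t - t * f 1\<bar> \<le> f 1" for n
  proof -
    define k where "k = nat \<lfloor>real n * t\<rfloor>"
    have nt: "0 \<le> real n * t" using t by simp
    then have k: "real k \<le> real n * t" "real n * t \<le> real k + 1" by (auto simp: k_def)
    have "f (real k) \<le> f (real n * t)" using k by (intro mono) auto
    then have 1: "real k * f 1 \<le> real n * f t" using mult[of 1 k] mult[OF t, of n] by simp
    have "f (real n * t) \<le> f (real (Suc k))" using k nt by (intro mono) auto
    then have 2: "real n * f t \<le> (real k + 1) * f 1" using mult[of 1 "Suc k"] mult[OF t, of n] by (simp add: add.commute)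
    have 3: "real k * f 1 \<le> real n * t * f 1" "real n * t * f 1 \<le> (real k + 1) * f 1"
      using k nonneg[of 1] by (auto intro!: mult_right_mono)
    have "\<bar>real n * f t - real n * t * f 1\<bar> \<le> f 1"
      using 1 2 3 by (simp add: distrib_right abs_le_iff)
    moreover have "real n * f t - real n * t * f 1 = real n * (f t - t * f 1)" by (simp add: right_diff_distrib)
    ultimately show ?thesis by (simp add: abs_mult)
  qed
  show ?thesis
  proof (rule ccontr)
    assume "f t \<noteq> t * f 1"
    then obtain n where "f 1 < real n * \<bar>f t - t * f 1\<bar>"
      using reals_Archimedean3[of "\<bar>f t - t * f 1\<bar>"] by auto
    with close[of n] show False by simp
  qed
qed

locale square_integrable_subordinator = subordinator +
  assumes square_integrable_1: "integrable M (\<lambda>\<omega>. (X 1 \<omega>)\<^sup>2)"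
begin

lemma measurable_X [measurable]: "0 \<le> t \<Longrightarrow> X t \<in> borel_measurable M"
  by (rule random_variable)

lemma AE_nonneg: "0 \<le> t \<Longrightarrow> AE \<omega> in M. 0 \<le> X t \<omega>"
  using AE_increasing starts_at_zero by eventually_elim (auto dest: mono_onD[of _ _ 0 t])

lemma AE_le: "\<lbrakk>0 \<le> s; s \<le> t\<rbrakk> \<Longrightarrow> AE \<omega> in M. X s \<omega> \<le> X t \<omega>"
  using AE_increasing by eventually_elim (auto dest: mono_onD[of _ _ s t])

text \<open>
  By stationarity, and because \<open>X 0\<close> vanishes almost surely, the increment over a period of length \<open>h\<close> may be replaced
  by \<open>X h\<close> under any integral.
\<close>

lemma increment_integral:
  fixes g :: "real \<Rightarrow> real"
  assumes [measurable]: "g \<in> borel_measurable borel" and "0 \<le> s" "0 \<le> h"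
  shows "integrable M (\<lambda>\<omega>. g (X (s + h) \<omega> - X s \<omega>)) \<longleftrightarrow> integrable M (\<lambda>\<omega>. g (X h \<omega>))"
    and "expectation (\<lambda>\<omega>. g (X (s + h) \<omega> - X s \<omega>)) = expectation (\<lambda>\<omega>. g (X h \<omega>))"
proof -
  have [measurable]: "X (s + h) \<in> borel_measurable M" "X s \<in> borel_measurable M" "X h \<in> borel_measurable M" "X 0 \<in> borel_measurable M"
    using assms by (auto intro: random_variable)
  have ae: "AE \<omega> in M. g (X h \<omega> - X 0 \<omega>) = g (X h \<omega>)"
    using starts_at_zero by eventually_elim simp
  have "integrable M (\<lambda>\<omega>. g (X (s + h) \<omega> - X s \<omega>)) \<longleftrightarrow> integrable (distr M borel (\<lambda>\<omega>. X (s + h) \<omega> - X s \<omega>)) g"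
    by (simp add: integrable_distr_eq)
  also have "\<dots> \<longleftrightarrow> integrable M (\<lambda>\<omega>. g (X h \<omega> - X 0 \<omega>))"
    unfolding stationary_increments[OF assms(2,3)] by (simp add: integrable_distr_eq)
  also have "\<dots> \<longleftrightarrow> integrable M (\<lambda>\<omega>. g (X h \<omega>))"
    using ae by (intro integrable_cong_AE) auto
  finally show "integrable M (\<lambda>\<omega>. g (X (s + h) \<omega> - X s \<omega>)) \<longleftrightarrow> integrable M (\<lambda>\<omega>. g (X h \<omega>))" .
  have "expectation (\<lambda>\<omega>. g (X (s + h) \<omega> - X s \<omega>)) = integral\<^sup>L (distr M borel (\<lambda>\<omega>. X (s + h) \<omega> - X s \<omega>)) g"
    by (simp add: integral_distr)
  also have "\<dots> = expectation (\<lambda>\<omega>. g (X h \<omega> - X 0 \<omega>))"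
    unfolding stationary_increments[OF assms(2,3)] by (simp add: integral_distr)
  also have "\<dots> = expectation (\<lambda>\<omega>. g (X h \<omega>))"
    using ae by (intro integral_cong_AE) auto
  finally show "expectation (\<lambda>\<omega>. g (X (s + h) \<omega> - X s \<omega>)) = expectation (\<lambda>\<omega>. g (X h \<omega>))" .
qed

text \<open>
  At integer times the process is a sum of copies of \<open>X 1\<close>; at other times it is bounded by its value at a later
  integer.
\<close>

lemma square_integrable:
  assumes t: "0 \<le> t"
  shows "integrable M (\<lambda>\<omega>. (X t \<omega>)\<^sup>2)"
proof -
  have nat: "integrable M (\<lambda>\<omega>. (X (real n) \<omega>)\<^sup>2)" for n
  proof (induction n)
    case 0
    have "integrable M (\<lambda>\<omega>. 0 :: real)" by simp
    then show ?case
      by (rule integrable_cong_AE_imp) (use starts_at_zero in \<open>auto elim!: eventually_mono\<close>)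
  next
    case (Suc n)
    have "integrable M (\<lambda>\<omega>. (X (real n + 1) \<omega> - X (real n) \<omega>)\<^sup>2)"
      using increment_integral(1)[of "\<lambda>x. x\<^sup>2" "real n" 1] square_integrable_1 by simp
    with Suc.IH have "integrable M (\<lambda>\<omega>. 2 * (X (real n + 1) \<omega> - X (real n) \<omega>)\<^sup>2 + 2 * (X (real n) \<omega>)\<^sup>2)"
      by (intro Bochner_Integration.integrable_add integrable_mult_right)
    then show ?case
    proof (rule Bochner_Integration.integrable_bound)
      show "AE \<omega> in M. norm ((X (real (Suc n)) \<omega>)\<^sup>2)
          \<le> norm (2 * (X (real n + 1) \<omega> - X (real n) \<omega>)\<^sup>2 + 2 * (X (real n) \<omega>)\<^sup>2)"
      proof (rule AE_I2)
        fix \<omega>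
        show "norm ((X (real (Suc n)) \<omega>)\<^sup>2)
            \<le> norm (2 * (X (real n + 1) \<omega> - X (real n) \<omega>)\<^sup>2 + 2 * (X (real n) \<omega>)\<^sup>2)"
          using square_diff_le[of "X (real n + 1) \<omega>" 0 "X (real n) \<omega>"] by (simp add: add.commute)
      qed
    qed auto
  qed
  obtain n where n: "t \<le> real n" using real_arch_simple by blast
  show ?thesis
  proof (rule Bochner_Integration.integrable_bound[OF nat[of n]])
    show "AE \<omega> in M. norm ((X t \<omega>)\<^sup>2) \<le> norm ((X (real n) \<omega>)\<^sup>2)"
      using AE_nonneg[OF t] AE_le[OF t n] by eventually_elim (simp add: power_mono)
  qed (use t in auto)
qed

lemma integrable_X: "0 \<le> t \<Longrightarrow> integrable M (X t)"
  using square_integrable[of t] measurable_X[of t] square_integrable_imp_integrable by blast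

definition mean :: real where "mean = expectation (X 1)"

definition var :: real where "var = expectation (\<lambda>\<omega>. (X 1 \<omega>)\<^sup>2) - mean\<^sup>2"

lemma expectation_X:
  assumes "0 \<le> t"
  shows "expectation (X t) = t * mean"
  unfolding mean_def
proof (rule additive_nonneg_imp_linear)
  show "expectation (X (s + h)) = expectation (X s) + expectation (X h)" if "0 \<le> s" "0 \<le> h" for s h
    using increment_integral(2)[of "\<lambda>x. x" s h] that integrable_X by simp
  show "0 \<le> expectation (X t)" if "0 \<le> t" for t
    using AE_nonneg[OF that] by (rule integral_nonneg_AE)
qed fact

text \<open>
  The increments over \<open>{0..s}\<close> and \<open>{s..t}\<close> are independent, and \<open>X 0\<close> vanishes almost surely.
\<close>

lemma increment_product:
  assumes st: "0 \<le> s" "s \<le> t"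
  shows "has_bochner_integral M (\<lambda>\<omega>. X s \<omega> * (X t \<omega> - X s \<omega>)) (s * mean * ((t - s) * mean))"
proof -
  \<comment> \<open>The partition \<open>0 \<le> s \<le> t\<close>.\<close>
  define r where "r i = (if i = 0 then 0 else if i = 1 then s else t)" for i :: nat
  define D where "D i \<omega> = X (r (Suc i)) \<omega> - X (r i) \<omega>" for i \<omega>
  have indep: "indep_vars (\<lambda>_. borel) D {..<2}"
    unfolding D_def using st by (intro independent_increments) (auto simp: r_def)
  have int: "integrable M (D i)" if "i \<in> {..<2}" for i
    unfolding D_def using st by (intro Bochner_Integration.integrable_diff integrable_X) (auto simp: r_def)
  have prod: "(\<Prod>i<2. g i) = g 0 * g 1" for g :: "nat \<Rightarrow> real"
    by (simp add: numeral_2_eq_2)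
  have m: "expectation (\<lambda>\<omega>. X t \<omega> - X s \<omega>) = (t - s) * mean" "expectation (\<lambda>\<omega>. X s \<omega> - X 0 \<omega>) = s * mean"
    using st expectation_X integrable_X by (simp_all add: algebra_simps)
  have "has_bochner_integral M (\<lambda>\<omega>. D 0 \<omega> * D 1 \<omega>) (expectation (D 0) * expectation (D 1))"
    using indep_vars_lebesgue_integral[OF _ indep int] indep_vars_integrable[OF _ indep int]
    by (simp add: has_bochner_integral_iff prod)
  moreover have "expectation (D 0) * expectation (D 1) = s * mean * ((t - s) * mean)"
    using m by (simp add: D_def[abs_def] r_def)
  ultimately have "has_bochner_integral M (\<lambda>\<omega>. D 0 \<omega> * D 1 \<omega>) (s * mean * ((t - s) * mean))" by simp
  then show ?thesis
  proof (rule has_bochner_integral_cong_AE[THEN iffD1, rotated 3])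
    show "AE \<omega> in M. D 0 \<omega> * D 1 \<omega> = X s \<omega> * (X t \<omega> - X s \<omega>)"
      using starts_at_zero by eventually_elim (simp add: D_def r_def)
    have [measurable]: "X s \<in> borel_measurable M" "X t \<in> borel_measurable M" "X 0 \<in> borel_measurable M"
      using st by (auto intro: random_variable)
    show "(\<lambda>\<omega>. D 0 \<omega> * D 1 \<omega>) \<in> borel_measurable M" unfolding D_def r_def by simp
    show "(\<lambda>\<omega>. X s \<omega> * (X t \<omega> - X s \<omega>)) \<in> borel_measurable M" by measurable
  qed
qed

text \<open>
  The variance is additive in time and nonnegative, hence linear.
\<close>

lemma expectation_square:
  assumes t: "0 \<le> t"
  shows "expectation (\<lambda>\<omega>. (X t \<omega>)\<^sup>2) = t * var + t\<^sup>2 * mean\<^sup>2"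
proof -
  define q where "q t = expectation (\<lambda>\<omega>. (X t \<omega>)\<^sup>2)" for t
  have "q t - (t * mean)\<^sup>2 = t * (q 1 - (1 * mean)\<^sup>2)"
  proof (rule additive_nonneg_imp_linear[where f = "\<lambda>t. q t - (t * mean)\<^sup>2"])
    fix s h :: real assume sh: "0 \<le> s" "0 \<le> h"
    have 1: "integrable M (\<lambda>\<omega>. (X s \<omega>)\<^sup>2)" using sh by (intro square_integrable)
    have 2: "has_bochner_integral M (\<lambda>\<omega>. X s \<omega> * (X (s + h) \<omega> - X s \<omega>)) (s * mean * (h * mean))"
      using increment_product[of s "s + h"] sh by simp
    have 3: "integrable M (\<lambda>\<omega>. (X (s + h) \<omega> - X s \<omega>)\<^sup>2)" "expectation (\<lambda>\<omega>. (X (s + h) \<omega> - X s \<omega>)\<^sup>2) = q h"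
      using increment_integral[of "\<lambda>x. x\<^sup>2" s h] sh square_integrable by (auto simp: q_def)
    have "q (s + h) = expectation (\<lambda>\<omega>. (X s \<omega>)\<^sup>2 + 2 * (X s \<omega> * (X (s + h) \<omega> - X s \<omega>)) + (X (s + h) \<omega> - X s \<omega>)\<^sup>2)"
      unfolding q_def by (intro Bochner_Integration.integral_cong) (auto simp: power2_eq_square algebra_simps)
    also have "\<dots> = q s + 2 * (s * mean * (h * mean)) + q h"
      using 1 2 3 by (simp add: has_bochner_integral_iff q_def)
    finally show "q (s + h) - ((s + h) * mean)\<^sup>2 = q s - (s * mean)\<^sup>2 + (q h - (h * mean)\<^sup>2)"
      by (simp add: power2_eq_square algebra_simps)
  next
    fix t :: real assume t: "0 \<le> t"
    have "variance (X t) = q t - (t * mean)\<^sup>2"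
      using variance_eq[OF integrable_X[OF t] square_integrable[OF t]] expectation_X[OF t] by (simp add: q_def)
    then show "0 \<le> q t - (t * mean)\<^sup>2" using variance_positive[of "X t"] by simp
  qed fact
  then show ?thesis by (simp add: q_def var_def power_mult_distrib algebra_simps)
qed

lemma var_nonneg: "0 \<le> var"
  using variance_eq[OF integrable_X square_integrable_1] variance_positive[of "X 1"]
  by (simp add: var_def mean_def)

lemma product_moment_X:
  assumes "0 \<le> s" "0 \<le> t"
  shows "has_bochner_integral M (\<lambda>\<omega>. X s \<omega> * X t \<omega>) (var * min s t + mean\<^sup>2 * (s * t))"
proof -
  have *: "has_bochner_integral M (\<lambda>\<omega>. X s \<omega> * X t \<omega>) (var * min s t + mean\<^sup>2 * (s * t))"
    if st: "0 \<le> s" "s \<le> t" for s t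
  proof -
    have "has_bochner_integral M (\<lambda>\<omega>. (X s \<omega>)\<^sup>2) (s * var + s\<^sup>2 * mean\<^sup>2)"
      using square_integrable[OF st(1)] expectation_square[OF st(1)] by (simp add: has_bochner_integral_iff)
    from has_bochner_integral_add[OF this increment_product[OF st]]
    have "has_bochner_integral M (\<lambda>\<omega>. (X s \<omega>)\<^sup>2 + X s \<omega> * (X t \<omega> - X s \<omega>))
      (s * var + s\<^sup>2 * mean\<^sup>2 + s * mean * ((t - s) * mean))" .
    moreover have "(\<lambda>\<omega>. (X s \<omega>)\<^sup>2 + X s \<omega> * (X t \<omega> - X s \<omega>)) = (\<lambda>\<omega>. X s \<omega> * X t \<omega>)"
      by (simp add: power2_eq_square algebra_simps)
    moreover have "s * var + s\<^sup>2 * mean\<^sup>2 + s * mean * ((t - s) * mean) = var * min s t + mean\<^sup>2 * (s * t)"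
      using st by (simp add: power2_eq_square algebra_simps)
    ultimately show ?thesis by simp
  qed
  show ?thesis
    using *[of s t] *[of t s] assms by (cases "s \<le> t") (auto simp: mult.commute min.commute)
qed

text \<open>
  The jump at \<open>t\<close> is nonnegative and at most the increment from \<open>r n\<close> to \<open>t\<close>, whose expectation tends to zero as
  \<open>r n\<close> increases to \<open>t\<close>.
\<close>

lemma AE_left_limit_eq:
  assumes t: "0 < t"
  shows "AE \<omega> in M. Lim (at_left t) (\<lambda>s. X s \<omega>) = X t \<omega>"
proof -
  define r where "r n = t - t / real (Suc n)" for n
  have r: "0 \<le> r n" "r n < t" for n
    using t by (auto simp: r_def field_simps)
  have r_lim: "r \<longlonglongrightarrow> t"
    unfolding r_def using tendsto_diff[OF tendsto_const[of t] tendsto_mult[OF tendsto_const[of t] LIMSEQ_inverse_real_of_nat]]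
    by (simp add: divide_inverse)
  have r_left: "filterlim r (at_left t) sequentially"
    using r_lim r by (auto simp: filterlim_at less_imp_neq intro!: always_eventually)
  \<comment> \<open>A measurable version of the left limit, whose values are arbitrary where no limit exists.\<close>
  define L where "L \<omega> = lim (\<lambda>n. X (r n) \<omega>)" for \<omega>
  have [measurable]: "X (r n) \<in> borel_measurable M" "X t \<in> borel_measurable M" for n
    using r t by (auto intro: random_variable)
  have [measurable]: "L \<in> borel_measurable M" unfolding L_def by measurable
  have L: "AE \<omega> in M. Lim (at_left t) (\<lambda>s. X s \<omega>) = L \<omega> \<and> (\<forall>n. X (r n) \<omega> \<le> L \<omega>) \<and> L \<omega> \<le> X t \<omega>"
    using AE_cadlag AE_increasing
  proof eventually_elim
    case (elim \<omega>)
    then obtain l where l: "((\<lambda>s. X s \<omega>) \<longlongrightarrow> l) (at_left t)" using t by (auto simp: cadlag_path_def)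
    have Lim: "Lim (at_left t) (\<lambda>s. X s \<omega>) = l" using l by (intro tendsto_Lim) auto
    have "L \<omega> = l" unfolding L_def using filterlim_compose[OF l r_left] by (rule limI)
    moreover have "X (r n) \<omega> \<le> l" for n
    proof (rule tendsto_lowerbound[OF l])
      show "eventually (\<lambda>s. X (r n) \<omega> \<le> X s \<omega>) (at_left t)"
        using eventually_at_left_real[OF r(2)[of n]]
        by eventually_elim (use r(1)[of n] elim(2) in \<open>auto intro: mono_onD\<close>)
    qed auto
    moreover have "l \<le> X t \<omega>"
    proof (rule tendsto_upperbound[OF l])
      show "eventually (\<lambda>s. X s \<omega> \<le> X t \<omega>) (at_left t)"
        using eventually_at_left_real[OF t]
        by eventually_elim (use t elim(2) in \<open>auto intro: mono_onD\<close>)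
    qed auto
    ultimately show ?case using Lim by simp
  qed
  have le: "(\<integral>\<^sup>+ \<omega>. ennreal (X t \<omega> - L \<omega>) \<partial>M) \<le> ennreal ((t - r n) * mean)" for n
  proof -
    have "(\<integral>\<^sup>+ \<omega>. ennreal (X t \<omega> - L \<omega>) \<partial>M) \<le> (\<integral>\<^sup>+ \<omega>. ennreal (X t \<omega> - X (r n) \<omega>) \<partial>M)"
    proof (rule nn_integral_mono_AE)
      show "AE \<omega> in M. ennreal (X t \<omega> - L \<omega>) \<le> ennreal (X t \<omega> - X (r n) \<omega>)"
        using L by eventually_elim (auto intro!: ennreal_leI)
    qed
    also have "\<dots> = ennreal (expectation (\<lambda>\<omega>. X t \<omega> - X (r n) \<omega>))"
      using AE_le[OF r(1) less_imp_le[OF r(2)]] r t integrable_X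
      by (intro nn_integral_eq_integral) (auto elim!: eventually_mono)
    also have "expectation (\<lambda>\<omega>. X t \<omega> - X (r n) \<omega>) = (t - r n) * mean"
      using r t integrable_X expectation_X by (simp add: left_diff_distrib)
    finally show ?thesis .
  qed
  have "(\<lambda>n. ennreal ((t - r n) * mean)) \<longlonglongrightarrow> ennreal ((t - t) * mean)"
    by (intro tendsto_ennrealI tendsto_intros r_lim)
  then have "(\<integral>\<^sup>+ \<omega>. ennreal (X t \<omega> - L \<omega>) \<partial>M) \<le> ennreal ((t - t) * mean)"
    by (rule LIMSEQ_le_const) (use le in auto)
  then have "(\<integral>\<^sup>+ \<omega>. ennreal (X t \<omega> - L \<omega>) \<partial>M) = 0" by simp
  then have "AE \<omega> in M. ennreal (X t \<omega> - L \<omega>) = 0"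
    by (subst (asm) nn_integral_0_iff_AE) auto
  with L show ?thesis by eventually_elim (auto simp: ennreal_eq_0_iff)
qed

text \<open>
  The expectation of the series is finite, since \<open>E (X (n + 1))\<close> is a multiple of \<open>n + 1\<close> and the exponent of the
  resulting power is \<open>d - 1 < - 1\<close>.
\<close>

lemma AE_summable_weighted:
  assumes a: "0 < a" and d: "d < 0"
  shows "AE \<omega> in M. summable (\<lambda>n. (a + real n) powr (d - 2) * X (real n + 1) \<omega>)"
proof -
  define c where "c n \<omega> = (a + real n) powr (d - 2) * X (real n + 1) \<omega>" for n \<omega>
  have c [measurable]: "c n \<in> borel_measurable M" for n
    unfolding c_def by (intro borel_measurable_times borel_measurable_const random_variable) auto
  have c_nonneg: "AE \<omega> in M. \<forall>n. 0 \<le> c n \<omega>"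
    unfolding AE_all_countable
  proof
    fix n
    show "AE \<omega> in M. 0 \<le> c n \<omega>"
      unfolding c_def using AE_nonneg[of "real n + 1"] by (auto elim!: eventually_mono)
  qed
  have mean: "0 \<le> mean" unfolding mean_def using AE_nonneg[of 1] by (intro integral_nonneg_AE) auto
  have E: "(\<integral>\<^sup>+ \<omega>. ennreal (c n \<omega>) \<partial>M) = ennreal ((a + real n) powr (d - 2) * ((real n + 1) * mean))" for n
  proof -
    have "(\<integral>\<^sup>+ \<omega>. ennreal (c n \<omega>) \<partial>M) = ennreal (expectation (c n))"
      using c_nonneg integrable_X[of "real n + 1"] unfolding c_def
      by (intro nn_integral_eq_integral integrable_mult_right) (auto elim!: eventually_mono)
    also have "expectation (c n) = (a + real n) powr (d - 2) * ((real n + 1) * mean)"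
      unfolding c_def using expectation_X[of "real n + 1"] by simp
    finally show ?thesis .
  qed
  have "summable (\<lambda>n. (1 + 1 / a) * mean * real n powr (d - 1))"
    using d by (intro summable_mult) (simp add: summable_real_powr_iff)
  then have summable: "summable (\<lambda>n. (a + real n) powr (d - 2) * ((real n + 1) * mean))"
  proof (rule summable_comparison_test_ev[rotated])
    show "eventually (\<lambda>n. norm ((a + real n) powr (d - 2) * ((real n + 1) * mean))
        \<le> (1 + 1 / a) * mean * real n powr (d - 1)) sequentially"
      using eventually_gt_at_top[of 0]
    proof eventually_elim
      case (elim n)
      have "real n + 1 \<le> (1 + 1 / a) * (a + real n)" using a by (simp add: field_simps)
      then have "(a + real n) powr (d - 2) * (real n + 1) \<le> (a + real n) powr (d - 2) * ((1 + 1 / a) * (a + real n))"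
        by (intro mult_left_mono) auto
      also have "\<dots> = (1 + 1 / a) * (a + real n) powr (d - 1)"
        using a powr_mult_base[of "a + real n" "d - 2"] by (simp add: mult.commute)
      also have "\<dots> \<le> (1 + 1 / a) * real n powr (d - 1)"
        using a d elim by (intro mult_left_mono powr_mono2') auto
      finally have "(a + real n) powr (d - 2) * (real n + 1) * mean \<le> (1 + 1 / a) * real n powr (d - 1) * mean"
        using mean by (intro mult_right_mono)
      then show ?case using mean by (simp add: mult_ac)
    qed
  qed
  have "(\<integral>\<^sup>+ \<omega>. (\<Sum>n. ennreal (c n \<omega>)) \<partial>M) = (\<Sum>n. ennreal ((a + real n) powr (d - 2) * ((real n + 1) * mean)))"
    by (subst nn_integral_suminf) (simp_all add: E)
  also have "\<dots> \<noteq> \<infinity>"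
    using summable mean by (intro ennreal_suminf_neq_top[unfolded infinity_ennreal_def[symmetric]]) auto
  finally have "AE \<omega> in M. (\<Sum>n. ennreal (c n \<omega>)) \<noteq> \<infinity>"
    by (intro nn_integral_noteq_infinite) auto
  with c_nonneg show ?thesis
    unfolding c_def[symmetric] by eventually_elim (intro summable_suminf_not_top, auto)
qed

end

section \<open>The two-sided process\<close>

text \<open>
  On the negative half line the path is minus the left-limit path of \<open>S1\<close>, run backwards.  Between \<open>- (n + 1)\<close> and
  \<open>- n\<close> its modulus is at most \<open>S1 (n + 1)\<close>, so that the series controls the weighted integral.
\<close>

lemma tempered_path_two_sided:
  fixes S1 S2 :: "real \<Rightarrow> 'a \<Rightarrow> real"
  assumes a: "0 < a" and d: "d < 0"
    and cadlag: "cadlag_path (\<lambda>t. S1 t \<omega>)"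
    and mono1: "mono_on {0..} (\<lambda>t. S1 t \<omega>)" and mono2: "mono_on {0..} (\<lambda>t. S2 t \<omega>)"
    and zero: "S1 0 \<omega> = 0" "S2 0 \<omega> = 0"
    and summable: "summable (\<lambda>n. (a + real n) powr (d - 2) * S1 (real n + 1) \<omega>)"
  shows "tempered_path a d (\<lambda>t. two_sided S1 S2 t \<omega>)"
proof -
  define x where "x t = two_sided S1 S2 t \<omega>" for t
  define l where "l t = Lim (at_left t) (\<lambda>s. S1 s \<omega>)" for t
  have x: "x t = (if t < 0 then - l (- t) else S2 t \<omega>)" for t
    by (simp add: x_def two_sided_def l_def)
  have lim: "((\<lambda>s. S1 s \<omega>) \<longlongrightarrow> l t) (at_left t)" if t: "0 < t" for t
  proof -
    obtain k where "((\<lambda>s. S1 s \<omega>) \<longlongrightarrow> k) (at_left t)" using cadlag t by (auto simp: cadlag_path_def)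
    moreover from this have "l t = k" unfolding l_def by (intro tendsto_Lim) auto
    ultimately show ?thesis by simp
  qed
  have l_le: "l t \<le> S1 t \<omega>" if t: "0 < t" for t
  proof (rule tendsto_upperbound[OF lim[OF t]])
    show "eventually (\<lambda>s. S1 s \<omega> \<le> S1 t \<omega>) (at_left t)"
      using eventually_at_left_real[OF t] by eventually_elim (use t mono1 in \<open>auto intro: mono_onD\<close>)
  qed auto
  have l_ge: "S1 s \<omega> \<le> l t" if st: "0 \<le> s" "s < t" for s t
  proof (rule tendsto_lowerbound[OF lim])
    show "eventually (\<lambda>r. S1 s \<omega> \<le> S1 r \<omega>) (at_left t)"
      using eventually_at_left_real[OF st(2)] by eventually_elim (use st mono1 in \<open>auto intro: mono_onD\<close>)
  qed (use st in auto)
  have l_nonneg: "0 \<le> l t" if "0 < t" for t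
    using l_ge[of 0 t] that zero by simp
  have mono: "mono x"
  proof (rule monoI)
    fix s t :: real assume st: "s \<le> t"
    consider "s = t" | "s < t" "t < 0" | "s < 0" "0 \<le> t" | "0 \<le> s" using st by linarith
    then show "x s \<le> x t"
    proof cases
      case 2
      then have "l (- t) \<le> S1 (- t) \<omega>" "S1 (- t) \<omega> \<le> l (- s)" using l_le[of "- t"] l_ge[of "- t" "- s"] by auto
      then show ?thesis using 2 by (simp add: x)
    next
      case 3
      then have "0 \<le> l (- s)" "0 \<le> S2 t \<omega>"
        using l_nonneg[of "- s"] mono_onD[OF mono2, of 0 t] zero by auto
      then show ?thesis using 3 by (simp add: x)
    qed (use st mono_onD[OF mono2, of s t] in \<open>auto simp: x\<close>)
  qed
  have [measurable]: "x \<in> borel_measurable borel" using mono by (rule borel_measurable_mono)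
  have x0: "x 0 = 0" using zero by (simp add: x)
  define c where "c n = (a + real n) powr (d - 2) * S1 (real n + 1) \<omega>" for n
  have S1_nonneg: "0 \<le> S1 t \<omega>" if "0 \<le> t" for t using mono_onD[OF mono1, of 0 t] that zero by simp
  have c_nonneg: "0 \<le> c n" for n unfolding c_def using S1_nonneg by simp
  let ?f = "\<lambda>s. indicator {..0} s *\<^sub>R (shifted_power a (d - 2) 0 s * x s)"
  let ?I = "\<lambda>n. {- (real n + 1)<..- real n}"
  have bound: "ennreal \<bar>?f s\<bar> \<le> (\<Sum>n. ennreal (c n) * indicator (?I n) s)" for s
  proof (cases "s < 0")
    case True
    define n where "n = nat \<lfloor>- s\<rfloor>"
    have n: "real n \<le> - s" "- s < real n + 1" using True by (auto simp: n_def)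
    have "\<bar>x s\<bar> = l (- s)" using True l_nonneg[of "- s"] by (simp add: x)
    also have "\<dots> \<le> S1 (real n + 1) \<omega>"
      using l_le[of "- s"] mono_onD[OF mono1, of "- s" "real n + 1"] True n by simp
    finally have xs: "\<bar>x s\<bar> \<le> S1 (real n + 1) \<omega>" .
    have "shifted_power a (d - 2) 0 s \<le> (a + real n) powr (d - 2)"
      unfolding shifted_power_def using True n a d by (intro powr_mono2') auto
    then have "\<bar>?f s\<bar> \<le> c n"
      using True xs by (auto simp: abs_mult c_def intro!: mult_mono)
    then have "ennreal \<bar>?f s\<bar> \<le> ennreal (c n) * indicator (?I n) s"
      using n by (simp add: ennreal_leI)
    also have "\<dots> \<le> (\<Sum>n. ennreal (c n) * indicator (?I n) s)"
    proof -
      have "g n \<le> suminf g" for g :: "nat \<Rightarrow> ennreal"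
        using sum_le_suminf[of g "{n}"] by simp
      then show ?thesis .
    qed
    finally show ?thesis .
  next
    case False
    then show ?thesis using x0 by (cases "s = 0") auto
  qed
  have "integrable lborel ?f"
    unfolding integrable_iff_bounded
  proof
    have "(\<integral>\<^sup>+ s. ennreal (norm (?f s)) \<partial>lborel) \<le> (\<integral>\<^sup>+ s. (\<Sum>n. ennreal (c n) * indicator (?I n) s) \<partial>lborel)"
      using bound by (intro nn_integral_mono) simp
    also have "\<dots> = (\<Sum>n. \<integral>\<^sup>+ s. ennreal (c n) * indicator (?I n) s \<partial>lborel)"
      by (intro nn_integral_suminf) auto
    also have "\<dots> = (\<Sum>n. ennreal (c n))"
      by (intro suminf_cong) (simp add: nn_integral_cmult_indicator)
    also have "\<dots> < \<infinity>"
      using ennreal_suminf_neq_top[OF summable[folded c_def] c_nonneg] by (simp add: less_top)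
    finally show "(\<integral>\<^sup>+ s. ennreal (norm (?f s)) \<partial>lborel) < \<infinity>" .
  qed auto
  then have "tempered_path a d x"
    using a d mono x0 by (simp add: tempered_path_def set_integrable_def)
  then show ?thesis by (simp add: x_def[abs_def])
qed

lemma tempered_path_zero: "0 < a \<Longrightarrow> d < 0 \<Longrightarrow> tempered_path a d (\<lambda>_. 0)"
  by (simp add: tempered_path_def mono_def set_integrable_def)

lemma measurable_path_space_component: "0 \<le> t \<Longrightarrow> (\<lambda>w. w t) \<in> measurable path_space borel"
  unfolding path_space_def by (intro measurable_component_singleton) auto

lemma measurable_sample_path:
  assumes "\<And>t. 0 \<le> t \<Longrightarrow> X t \<in> borel_measurable M"
  shows "sample_path X \<in> measurable M path_space"
proof -
  have "sample_path X = (\<lambda>\<omega>. \<lambda>t\<in>{0..}. X t \<omega>)" by (simp add: sample_path_def fun_eq_iff)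
  then show ?thesis unfolding path_space_def using assms by (auto intro!: measurable_restrict)
qed

lemma distr_sample_path:
  assumes X: "\<And>t. 0 \<le> t \<Longrightarrow> X t \<in> borel_measurable M" and t: "0 \<le> t"
  shows "distr M borel (X t) = distr (distr M path_space (sample_path X)) borel (\<lambda>w. w t)"
  using t by (subst distr_distr[OF measurable_path_space_component[OF t] measurable_sample_path[OF X]])
    (auto simp: sample_path_def comp_def)

lemma same_law_marginal:
  assumes law: "same_law M X N Y"
    and X: "\<And>t. 0 \<le> t \<Longrightarrow> X t \<in> borel_measurable M" and Y: "\<And>t. 0 \<le> t \<Longrightarrow> Y t \<in> borel_measurable N"
    and t: "0 \<le> t"
  shows "distr M borel (X t) = distr N borel (Y t)"
  using distr_sample_path[of X M t] distr_sample_path[of Y N t] X Y t law by (simp add: same_law_def)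

section \<open>The integral representation\<close>

theorem proposition2p3:
  fixes N :: "'b measure" and S :: "real \<Rightarrow> 'b \<Rightarrow> real"
    and M :: "'a measure" and S1 S2 :: "real \<Rightarrow> 'a \<Rightarrow> real"
    and a d :: real
  assumes "subordinator N S"
    and "integrable N (\<lambda>\<omega>. (S 1 \<omega>)\<^sup>2)"
    and "subordinator M S1" and "same_law M S1 N S"
    and "subordinator M S2" and "same_law M S2 N S"
    and "prob_space.indep_var M path_space (sample_path S1) path_space (sample_path S2)"
    and "- 0.5 < d" and "d < 0" and "a > 0"
  shows
    "(\<forall>t. \<exists>Z. has_L2_integral M (two_sided S1 S2) (mvn_kernel a d t) Z) \<and>
     (AE \<omega> in M. \<forall>t.
        (\<exists>I. has_improper_riemann_integral (riemann_integrand a d (two_sided S1 S2) t \<omega>) I) \<and>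
        riemann_integrable (\<lambda>s. two_sided S1 S2 s \<omega>) (min 0 t) (max 0 t)) \<and>
     (\<forall>X. (\<forall>t. has_L2_integral M (two_sided S1 S2) (mvn_kernel a d t) (X t)) \<longrightarrow>
        (\<exists>Y. modification M Y X \<and>
           (AE \<omega> in M. \<forall>t. Y t \<omega> = riemann_representation a d (two_sided S1 S2) t \<omega>))) \<and>
     (AE \<omega> in M.
        continuous_on UNIV (\<lambda>t. riemann_representation a d (two_sided S1 S2) t \<omega>) \<and>
        (\<forall>u v. u \<le> v \<longrightarrow>
           finite_variation_on (\<lambda>t. riemann_representation a d (two_sided S1 S2) t \<omega>) u v))"
proof -
  note d = \<open>d < 0\<close> and a = \<open>a > 0\<close>
  interpret N: subordinator N S by fact
  interpret S1: subordinator M S1 by fact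
  interpret S2: subordinator M S2 by fact
  have law1: "distr M borel (S1 t) = distr N borel (S t)" and law2: "distr M borel (S2 t) = distr N borel (S t)" if "0 \<le> t" for t
    using that assms(4,6) S1.random_variable S2.random_variable N.random_variable by (auto intro: same_law_marginal)
  have moment: "integrable M (\<lambda>\<omega>. (V \<omega>)\<^sup>2)" "(LINT \<omega>|M. (V \<omega>)\<^sup>2) = (LINT \<omega>|N. (S 1 \<omega>)\<^sup>2)" "(LINT \<omega>|M. V \<omega>) = (LINT \<omega>|N. S 1 \<omega>)"
    if law: "distr M borel V = distr N borel (S 1)" and [measurable]: "V \<in> borel_measurable M" for V
  proof -
    have [measurable]: "S 1 \<in> borel_measurable N" by (rule N.random_variable) simp
    have "integrable (distr N borel (S 1)) (\<lambda>x. x\<^sup>2)" using assms(2) by (simp add: integrable_distr_eq)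
    then show "integrable M (\<lambda>\<omega>. (V \<omega>)\<^sup>2)" unfolding law[symmetric] by (simp add: integrable_distr_eq)
    have "integral\<^sup>L (distr M borel V) g = integral\<^sup>L (distr N borel (S 1)) g" for g :: "real \<Rightarrow> real"
      by (simp only: law)
    from this[of "\<lambda>x. x\<^sup>2"] this[of "\<lambda>x. x"]
    show "(LINT \<omega>|M. (V \<omega>)\<^sup>2) = (LINT \<omega>|N. (S 1 \<omega>)\<^sup>2)" "(LINT \<omega>|M. V \<omega>) = (LINT \<omega>|N. S 1 \<omega>)"
      by (simp_all add: integral_distr)
  qed
  note moment1 = moment[OF law1[of 1] S1.random_variable[of 1], simplified]
  note moment2 = moment[OF law2[of 1] S2.random_variable[of 1], simplified]
  interpret S1: square_integrable_subordinator M S1 by unfold_locales (rule moment1)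
  interpret S2: square_integrable_subordinator M S2 by unfold_locales (rule moment2)
  have mean: "S2.mean = S1.mean" and var: "S2.var = S1.var"
    by (simp_all add: S1.mean_def S2.mean_def S1.var_def S2.var_def moment1 moment2)

  have "AE \<omega> in M. cadlag_path (\<lambda>t. S1 t \<omega>) \<and> mono_on {0..} (\<lambda>t. S1 t \<omega>) \<and> mono_on {0..} (\<lambda>t. S2 t \<omega>)
      \<and> S1 0 \<omega> = 0 \<and> S2 0 \<omega> = 0 \<and> summable (\<lambda>n. (a + real n) powr (d - 2) * S1 (real n + 1) \<omega>)"
    using S1.AE_cadlag S1.AE_increasing S2.AE_increasing S1.starts_at_zero S2.starts_at_zero S1.AE_summable_weighted[OF a d]
    by eventually_elim simp
  then obtain E where E: "E \<in> null_sets M"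
    and good: "\<And>\<omega>. \<omega> \<in> space M - E \<Longrightarrow> cadlag_path (\<lambda>t. S1 t \<omega>) \<and> mono_on {0..} (\<lambda>t. S1 t \<omega>) \<and> mono_on {0..} (\<lambda>t. S2 t \<omega>)
      \<and> S1 0 \<omega> = 0 \<and> S2 0 \<omega> = 0 \<and> summable (\<lambda>n. (a + real n) powr (d - 2) * S1 (real n + 1) \<omega>)"
    by (rule AE_E3) blast
  \<comment> \<open>Replacing all paths outside \<open>G\<close> by zero makes every path tempered and every time value measurable.\<close>
  define G where "G = space M - E"
  have [measurable]: "G \<in> sets M" using E by (auto simp: G_def)
  have AE_G: "AE \<omega> in M. \<omega> \<in> G"
    using AE_not_in[OF E] by (auto simp: G_def)
  define X' where "X' t \<omega> = (if \<omega> \<in> G then two_sided S1 S2 t \<omega> else 0)" for t \<omega>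
  have path: "tempered_path a d (\<lambda>t. X' t \<omega>)" for \<omega>
  proof (cases "\<omega> \<in> G")
    case True
    then show ?thesis
      using tempered_path_two_sided[OF a d, of S1 \<omega> S2] good[of \<omega>] by (simp add: X'_def G_def)
  qed (simp add: X'_def tempered_path_zero[OF a d])
  have X'_eq: "AE \<omega> in M. two_sided S1 S2 t \<omega> = X' t \<omega>" for t
    using AE_G by eventually_elim (simp add: X'_def)

  \<comment> \<open>At each fixed time the left limit may be dropped, which reduces moments to those of \<open>S1\<close> and \<open>S2\<close>.\<close>
  define U where "U t \<omega> = (if t < 0 then - S1 (- t) \<omega> else S2 t \<omega>)" for t \<omega>
  have U_meas [measurable]: "U t \<in> borel_measurable M" for t
    using S1.random_variable[of "- t"] S2.random_variable[of t] by (cases "t < 0") (auto simp: U_def[abs_def])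
  have X'_U: "AE \<omega> in M. U t \<omega> = X' t \<omega>" for t
  proof (cases "t < 0")
    case True
    then show ?thesis
      using S1.AE_left_limit_eq[of "- t"] X'_eq[of t] by (auto simp: U_def two_sided_def elim!: eventually_elim2)
  next
    case False
    then show ?thesis using X'_eq[of t] by (simp add: U_def two_sided_def)
  qed
  have X'_meas: "X' t \<in> borel_measurable M" for t
  proof (cases "t < 0")
    case False
    then have [measurable]: "S2 t \<in> borel_measurable M" by (intro S2.random_variable) simp
    have "X' t = (\<lambda>\<omega>. if \<omega> \<in> G then S2 t \<omega> else 0)" using False by (simp add: X'_def two_sided_def fun_eq_iff)
    then show ?thesis by simp
  next
    case True
    define r where "r n = - t - (- t) / real (Suc n)" for n
    have r: "0 \<le> r n" "r n < - t" for n using True by (auto simp: r_def field_simps mult_nonpos_nonneg)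
    have "r \<longlonglongrightarrow> - t"
      unfolding r_def using tendsto_diff[OF tendsto_const[of "- t"] tendsto_mult[OF tendsto_const[of "- t"] LIMSEQ_inverse_real_of_nat]]
      by (simp add: divide_inverse)
    then have r_left: "filterlim r (at_left (- t)) sequentially"
      using r by (auto simp: filterlim_at less_imp_neq intro!: always_eventually)
    have [measurable]: "S1 (r n) \<in> borel_measurable M" for n using r by (intro S1.random_variable)
    show ?thesis
    proof (rule borel_measurable_LIMSEQ_real)
      fix \<omega> assume "\<omega> \<in> space M"
      show "(\<lambda>n. if \<omega> \<in> G then - S1 (r n) \<omega> else 0) \<longlonglongrightarrow> X' t \<omega>"
      proof (cases "\<omega> \<in> G")
        case G: True
        then have "cadlag_path (\<lambda>t. S1 t \<omega>)" "0 < - t" using good[of \<omega>] True by (auto simp: G_def)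
        then obtain k where k: "((\<lambda>s. S1 s \<omega>) \<longlongrightarrow> k) (at_left (- t))"
          unfolding cadlag_path_def by blast
        then have "Lim (at_left (- t)) (\<lambda>s. S1 s \<omega>) = k" by (intro tendsto_Lim) auto
        with tendsto_minus[OF filterlim_compose[OF k r_left]] show ?thesis
          using G True by (simp add: X'_def two_sided_def)
      qed (simp add: X'_def)
    qed simp
  qed
  have product: "has_bochner_integral M (\<lambda>\<omega>. X' s \<omega> * X' t \<omega>)
      (S1.var * ((\<bar>s\<bar> + \<bar>t\<bar> - \<bar>s - t\<bar>) / 2) + S1.mean\<^sup>2 * (s * t))" for s t
  proof -
    have cross: "has_bochner_integral M (\<lambda>\<omega>. S1 s \<omega> * S2 t \<omega>) (S1.mean\<^sup>2 * (s * t))" if st: "0 \<le> s" "0 \<le> t" for s t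
    proof -
      have "S1.indep_var borel ((\<lambda>w. w s) \<circ> sample_path S1) borel ((\<lambda>w. w t) \<circ> sample_path S2)"
        using assms(7) st by (intro S1.indep_var_compose[OF assms(7)] measurable_path_space_component)
      moreover have "(\<lambda>w. w s) \<circ> sample_path S1 = S1 s" "(\<lambda>w. w t) \<circ> sample_path S2 = S2 t"
        using st by (auto simp: sample_path_def)
      ultimately have "S1.indep_var borel (S1 s) borel (S2 t)" by simp
      from S1.indep_var_lebesgue_integral[OF this] S1.indep_var_integrable[OF this] show ?thesis
        using st S1.integrable_X S2.integrable_X S1.expectation_X S2.expectation_X
        by (simp add: has_bochner_integral_iff mean power2_eq_square)
    qed
    have "has_bochner_integral M (\<lambda>\<omega>. U s \<omega> * U t \<omega>)
      (S1.var * ((\<bar>s\<bar> + \<bar>t\<bar> - \<bar>s - t\<bar>) / 2) + S1.mean\<^sup>2 * (s * t))"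
    proof -
      consider "s < 0" "t < 0" | "s < 0" "0 \<le> t" | "0 \<le> s" "t < 0" | "0 \<le> s" "0 \<le> t" by linarith
      then show ?thesis
      proof cases
        case 1
        moreover from 1 have "(\<bar>s\<bar> + \<bar>t\<bar> - \<bar>s - t\<bar>) / 2 = min (- s) (- t)" by (simp add: min_def abs_if)
        ultimately show ?thesis using S1.product_moment_X[of "- s" "- t"] by (simp add: U_def)
      next
        case 2
        then have "(\<bar>s\<bar> + \<bar>t\<bar> - \<bar>s - t\<bar>) / 2 = 0" by simp
        with 2 show ?thesis using has_bochner_integral_minus[OF cross[of "- s" t]] by (simp add: U_def)
      next
        case 3
        then have "(\<bar>s\<bar> + \<bar>t\<bar> - \<bar>s - t\<bar>) / 2 = 0" by simp
        with 3 show ?thesis using has_bochner_integral_minus[OF cross[of "- t" s]] by (simp add: U_def mult.commute)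
      next
        case 4
        moreover from 4 have "(\<bar>s\<bar> + \<bar>t\<bar> - \<bar>s - t\<bar>) / 2 = min s t" by (simp add: min_def abs_if)
        ultimately show ?thesis using S2.product_moment_X[of s t] by (simp add: U_def mean var)
      qed
    qed
    moreover have "AE \<omega> in M. U s \<omega> * U t \<omega> = X' s \<omega> * X' t \<omega>"
      using X'_U[of s] X'_U[of t] by eventually_elim simp
    ultimately show ?thesis
      using X'_meas by (subst has_bochner_integral_cong_AE[symmetric]) auto
  qed
  interpret X': second_order_process M X' S1.mean S1.var
    by unfold_locales (use X'_meas S1.var_nonneg product in auto)

  define R where "R t \<omega> = tempered_path.path_integral a d (\<lambda>s. X' s \<omega>) t" for t \<omega>
  have R: "has_L2_integral M X' (mvn_kernel a d t) (R t)" for t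
  proof (rule X'.has_L2_integral_pathwise_limit[OF grid_steps_approximating[OF a d]])
    fix \<omega>
    interpret tempered_path a d "\<lambda>s. X' s \<omega>" by (rule path)
    show "(\<lambda>n. step_integral X' (grid_steps (mvn_kernel a d t) (Suc n)) \<omega>) \<longlonglongrightarrow> R t \<omega>"
      using step_integral_grid_tendsto[of t \<omega>] by (simp add: R_def step_integral_def)
  qed simp
  have L2: "has_L2_integral M (two_sided S1 S2) (mvn_kernel a d t) Z \<longleftrightarrow> has_L2_integral M X' (mvn_kernel a d t) Z" for t Z
    using X'_eq by (rule has_L2_integral_cong_process)
  have rep: "AE \<omega> in M. \<forall>t. R t \<omega> = riemann_representation a d (two_sided S1 S2) t \<omega>"
    using AE_G
  proof eventually_elim
    case (elim \<omega>)
    interpret tempered_path a d "\<lambda>s. X' s \<omega>" by (rule path)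
    show ?case
      using elim riemann_representation_eq_path_integral[of "two_sided S1 S2" \<omega>] by (simp add: R_def X'_def)
  qed
  show ?thesis
  proof (intro conjI allI impI)
    show "\<exists>Z. has_L2_integral M (two_sided S1 S2) (mvn_kernel a d t) Z" for t
      using R L2 by blast
  next
    show "AE \<omega> in M. \<forall>t. (\<exists>I. has_improper_riemann_integral (riemann_integrand a d (two_sided S1 S2) t \<omega>) I) \<and>
        riemann_integrable (\<lambda>s. two_sided S1 S2 s \<omega>) (min 0 t) (max 0 t)"
      using AE_G
    proof eventually_elim
      case (elim \<omega>)
      interpret tempered_path a d "\<lambda>s. X' s \<omega>" by (rule path)
      have eq: "(\<lambda>s. two_sided S1 S2 s \<omega>) = (\<lambda>s. X' s \<omega>)" using elim by (simp add: X'_def)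
      show ?case
        unfolding riemann_integrand_eq[where X = "two_sided S1 S2" and \<omega> = \<omega>, OF eq] eq
        using has_improper_riemann_integral_shifted_power_diff has_riemann_integral_path
        unfolding riemann_integrable_def by (meson max.cobounded1 min.cobounded1 order_trans)
    qed
  next
    fix X assume X: "\<forall>t. has_L2_integral M (two_sided S1 S2) (mvn_kernel a d t) (X t)"
    have "modification M R X"
      unfolding modification_def
    proof (intro allI conjI)
      fix t
      show "R t \<in> borel_measurable M" using R[of t] by (simp add: has_L2_integral_def)
      show "AE \<omega> in M. R t \<omega> = X t \<omega>"
        using X L2 R X'.has_L2_integral_unique by blast
    qed
    with rep show "\<exists>Y. modification M Y X \<and> (AE \<omega> in M. \<forall>t. Y t \<omega> = riemann_representation a d (two_sided S1 S2) t \<omega>)"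
      by blast
  next
    show "AE \<omega> in M. continuous_on UNIV (\<lambda>t. riemann_representation a d (two_sided S1 S2) t \<omega>) \<and>
        (\<forall>u v. u \<le> v \<longrightarrow> finite_variation_on (\<lambda>t. riemann_representation a d (two_sided S1 S2) t \<omega>) u v)"
      using rep
    proof eventually_elim
      case (elim \<omega>)
      interpret tempered_path a d "\<lambda>s. X' s \<omega>" by (rule path)
      have eq: "(\<lambda>t. riemann_representation a d (two_sided S1 S2) t \<omega>) = path_integral"
        using elim by (auto simp: R_def fun_eq_iff)
      show ?case unfolding eq using continuous_path_integral finite_variation_path_integral by blast
    qed
  qed
qed

end
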